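(* Let $\Sigma$ be a $d$-dimensional hereditary rational polyhedral fan in $\mathbb{Q}^d$, let $S=\mathbb{Q}[x_1,\ldots,x_d]$, and let $\mathcal{C}=\mathcal{C}(\Sigma)$ be the cellular complex of $S$-modules defined in the context. For every $i$ with $1\le i\le d-1$, the homology module $H_{d-i}(\mathcal{C})$ is supported in codimension at least $i+1$ (that is, every prime in its support has codimension at least $i+1$), and every associated prime of $H_{d-i}(\mathcal{C})$ of codimension exactly $i+1$ is linear, i.e. generated by linear forms.
   Context: A fan consists of strongly convex rational polyhedral cones in $\mathbb{Q}^d$ (not necessarily simplicial, not necessarily complete). It is $d$-dimensional and hereditary: for every nonempty face $\sigma$ of $\Sigma$, the dual graph of the star of $\sigma$ (vertices: $d$-dimensional cones containing $\sigma$; edges: pairs of these sharing a $(d-1)$-dimensional face that contains $\sigma$) is connected, and in particular every cone lies in a $d$-dimensional cone. $\Sigma_k$ is the set of $k$-dimensional cones. $\Sigma_k^0\subseteq\Sigma_k$ is the set of interior ones, i.e. those not contained in the boundary of the support $|\Sigma|$, so $\Sigma_d^0=\Sigma_d$. For a cone $\xi$, $\overline{\xi}$ denotes its linear span and $I_\xi\subseteq S$ the ideal of $\overline{\xi}$, generated by the linear forms vanishing on it. Complex $\mathcal{C}$: fix an orientation of each cone. Let $\mathcal{C}_k=\bigoplus_{\xi\in\Sigma_k^0}S/I_\xi$ for $1\le k\le d$ (so $\mathcal{C}_d=\bigoplus_{\sigma\in\Sigma_d}S$) and $\mathcal{C}_k=0$ otherwise: $$0\to\bigoplus_{\sigma\in\Sigma_d}S\xrightarrow{\partial_d}\bigoplus_{\tau\in\Sigma_{d-1}^0}S/I_\tau\xrightarrow{\partial_{d-1}}\cdots\xrightarrow{\partial_2}\bigoplus_{v\in\Sigma_1^0}S/I_v\to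 0.$$ The differential $\partial_k$ is induced by the cellular boundary map relative to the boundary of $\Sigma$: the generator of a cone $\alpha$ maps to the sum, with incidence signs $\pm1$, of the generators of its interior facets. *)

theory Defs
  imports
    "HOL-Analysis.Cartesian_Space"
    "HOL-Library.Poly_Mapping"
    "HOL-Library.Extended_Nat"
    "HOL-Algebra.Algebraic_Closure_Type"
    "Jordan_Normal_Form.Determinant"
begin

section \<open>Rational polyhedral fans\<close>

text \<open>The ambient space \<open>\<rat>\<^sup>d\<close> is \<open>rat ^ 'n\<close> with \<open>d = CARD('n)\<close>.\<close>

definition dot :: "rat ^ 'n::finite \<Rightarrow> rat ^ 'n \<Rightarrow> rat" where
  "dot u x = (\<Sum>i\<in>UNIV. vec_nth u i * vec_nth x i)"

definition polyhedral_cone :: "(rat ^ 'n::finite) set \<Rightarrow> bool" where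
  "polyhedral_cone C \<longleftrightarrow>
     (\<exists>G. finite G \<and> C = {(\<Sum>g\<in>G. c g *s g) | c. \<forall>g\<in>G. 0 \<le> c g})"

definition strongly_convex :: "(rat ^ 'n::finite) set \<Rightarrow> bool" where
  "strongly_convex C \<longleftrightarrow> (\<forall>x. x \<in> C \<and> - x \<in> C \<longrightarrow> x = 0)"

text \<open>The case \<open>u = 0\<close> makes every cone a face of itself.\<close>

definition is_face :: "(rat ^ 'n::finite) set \<Rightarrow> (rat ^ 'n) set \<Rightarrow> bool" where
  "is_face F C \<longleftrightarrow> (\<exists>u. (\<forall>x\<in>C. 0 \<le> dot u x) \<and> F = {x \<in> C. dot u x = 0})"

definition is_fan :: "(rat ^ 'n::finite) set set \<Rightarrow> bool" where
  "is_fan \<Sigma> \<longleftrightarrow> finite \<Sigma> \<and>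
     (\<forall>C\<in>\<Sigma>. polyhedral_cone C \<and> strongly_convex C) \<and>
     (\<forall>C\<in>\<Sigma>. \<forall>F. is_face F C \<longrightarrow> F \<in> \<Sigma>) \<and>
     (\<forall>C\<in>\<Sigma>. \<forall>D\<in>\<Sigma>. is_face (C \<inter> D) C \<and> is_face (C \<inter> D) D)"

definition cones :: "(rat ^ 'n::finite) set set \<Rightarrow> nat \<Rightarrow> (rat ^ 'n) set set" where
  "cones \<Sigma> k = {\<xi> \<in> \<Sigma>. vec.dim \<xi> = k}"

definition full_dimensional :: "(rat ^ 'n::finite) set set \<Rightarrow> bool" where
  "full_dimensional \<Sigma> \<longleftrightarrow> cones \<Sigma> CARD('n) \<noteq> {}"

definition star_vertices ::
    "(rat ^ 'n::finite) set set \<Rightarrow> (rat ^ 'n) set \<Rightarrow> (rat ^ 'n) set set" where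
  "star_vertices \<Sigma> \<sigma> = {\<alpha> \<in> cones \<Sigma> CARD('n). \<sigma> \<subseteq> \<alpha>}"

definition star_edges ::
    "(rat ^ 'n::finite) set set \<Rightarrow> (rat ^ 'n) set \<Rightarrow> ((rat ^ 'n) set \<times> (rat ^ 'n) set) set" where
  "star_edges \<Sigma> \<sigma> = {(\<alpha>, \<beta>). \<alpha> \<in> star_vertices \<Sigma> \<sigma> \<and> \<beta> \<in> star_vertices \<Sigma> \<sigma> \<and> \<alpha> \<noteq> \<beta> \<and>
     (\<exists>\<tau> \<in> cones \<Sigma> (CARD('n) - 1). is_face \<tau> \<alpha> \<and> is_face \<tau> \<beta> \<and> \<sigma> \<subseteq> \<tau>)}"

text \<open>Connected graphs are nonempty, so every cone of a hereditary fan lies in a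
  full-dimensional cone. The zero cone is one of the nonempty faces.\<close>

definition hereditary :: "(rat ^ 'n::finite) set set \<Rightarrow> bool" where
  "hereditary \<Sigma> \<longleftrightarrow> (\<forall>\<sigma>\<in>\<Sigma>. \<sigma> \<noteq> {} \<longrightarrow> star_vertices \<Sigma> \<sigma> \<noteq> {} \<and>
     (\<forall>\<alpha>\<in>star_vertices \<Sigma> \<sigma>. \<forall>\<beta>\<in>star_vertices \<Sigma> \<sigma>. (\<alpha>, \<beta>) \<in> (star_edges \<Sigma> \<sigma>)\<^sup>*))"

text \<open>The type \<open>rat\<close> carries no topology in the library, so the topological boundary of a
  subset of \<open>\<rat>\<^sup>d\<close> is spelled out with open boxes.\<close>

definition open_box :: "rat ^ 'n::finite \<Rightarrow> rat \<Rightarrow> (rat ^ 'n) set" where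
  "open_box x e = {y. \<forall>i. \<bar>vec_nth y i - vec_nth x i\<bar> < e}"

definition rat_boundary :: "(rat ^ 'n::finite) set \<Rightarrow> (rat ^ 'n) set" where
  "rat_boundary A = {x. \<forall>e>0. (\<exists>y \<in> open_box x e. y \<in> A) \<and> (\<exists>y \<in> open_box x e. y \<notin> A)}"

definition interior_cones :: "(rat ^ 'n::finite) set set \<Rightarrow> nat \<Rightarrow> (rat ^ 'n) set set" where
  "interior_cones \<Sigma> k = {\<xi> \<in> cones \<Sigma> k. \<not> \<xi> \<subseteq> rat_boundary (\<Union>\<Sigma>)}"


section \<open>Orientations and incidence signs\<close>

text \<open>An orientation of a cone is given by an ordered basis of its linear span.\<close>

definition is_orientation ::
    "((rat ^ 'n::finite) set \<Rightarrow> (rat ^ 'n) list) \<Rightarrow> (rat ^ 'n) set set \<Rightarrow> bool" where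
  "is_orientation ori \<Sigma> \<longleftrightarrow> (\<forall>\<xi>\<in>\<Sigma>. distinct (ori \<xi>) \<and>
     vec.independent (set (ori \<xi>)) \<and> vec.span (set (ori \<xi>)) = vec.span \<xi>)"

text \<open>Sign of the change-of-basis determinant between two ordered bases of the same space.\<close>

definition orientation_sign ::
    "(rat ^ 'n::finite) list \<Rightarrow> (rat ^ 'n) list \<Rightarrow> rat" where
  "orientation_sign bs cs = sgn (Determinant.det
     (Matrix.mat (length bs) (length bs) (\<lambda>(i, j). vec.representation (set bs) (cs ! i) (bs ! j))))"

text \<open>Outward-normal-first convention for a facet \<open>\<beta>\<close> of \<open>\<alpha>\<close>: a vector \<open>v\<close> of \<open>\<alpha>\<close> outside the
  span of \<open>\<beta>\<close> points inwards, so \<open>- v\<close> points outwards. The sign does not depend on \<open>v\<close>.\<close>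

definition incidence ::
    "((rat ^ 'n::finite) set \<Rightarrow> (rat ^ 'n) list) \<Rightarrow> (rat ^ 'n) set \<Rightarrow> (rat ^ 'n) set \<Rightarrow> rat" where
  "incidence ori \<alpha> \<beta> =
     orientation_sign (ori \<alpha>) ((- (SOME v. v \<in> \<alpha> - vec.span \<beta>)) # ori \<beta>)"


section \<open>Modules\<close>

text \<open>The library's \<open>module\<close> record extends \<open>ring\<close>; the fields \<open>mult\<close> and \<open>one\<close> play no role
  in a module and are left undefined.\<close>

definition regular_module :: "('a, 'm) ring_scheme \<Rightarrow> ('a, 'a) module" where
  "regular_module R = \<lparr>carrier = carrier R, monoid.mult = undefined, one = undefined,
     ring.zero = \<zero>\<^bsub>R\<^esub>, add = (\<lambda>x y. x \<oplus>\<^bsub>R\<^esub> y), module.smult = (\<lambda>r x. r \<otimes>\<^bsub>R\<^esub> x)\<rparr>"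

definition quotient_module :: "('r, 'a) module \<Rightarrow> 'a set \<Rightarrow> ('r, 'a set) module" where
  "quotient_module M N = \<lparr>carrier = a_rcosets\<^bsub>M\<^esub> N, monoid.mult = undefined, one = undefined,
     ring.zero = N, add = (\<lambda>Y Z. Y <+>\<^bsub>M\<^esub> Z),
     module.smult = (\<lambda>r Y. \<Union>x\<in>Y. N +>\<^bsub>M\<^esub> (r \<odot>\<^bsub>M\<^esub> x))\<rparr>"

text \<open>The direct sum over a finite index set.\<close>

definition direct_sum_module ::
    "'i set \<Rightarrow> ('i \<Rightarrow> ('r, 'a) module) \<Rightarrow> ('r, 'i \<Rightarrow> 'a) module" where
  "direct_sum_module I M = \<lparr>carrier = (\<Pi>\<^sub>E i\<in>I. carrier (M i)),
     monoid.mult = undefined, one = undefined,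
     ring.zero = (\<lambda>i\<in>I. \<zero>\<^bsub>M i\<^esub>), add = (\<lambda>f g. \<lambda>i\<in>I. f i \<oplus>\<^bsub>M i\<^esub> g i),
     module.smult = (\<lambda>r f. \<lambda>i\<in>I. r \<odot>\<^bsub>M i\<^esub> f i)\<rparr>"

text \<open>The localization \<open>M\<^sub>P\<close> at a prime \<open>P\<close>: fractions \<open>m/s\<close> with \<open>s \<notin> P\<close>, as classes of pairs.\<close>

definition localization_rel ::
    "('r, 'k) ring_scheme \<Rightarrow> ('r, 'a) module \<Rightarrow> 'r set \<Rightarrow> (('a \<times> 'r) \<times> ('a \<times> 'r)) set" where
  "localization_rel R M P = {((m, s), (n, t)).
     m \<in> carrier M \<and> n \<in> carrier M \<and> s \<in> carrier R - P \<and> t \<in> carrier R - P \<and>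
     (\<exists>u \<in> carrier R - P. u \<odot>\<^bsub>M\<^esub> (t \<odot>\<^bsub>M\<^esub> m) = u \<odot>\<^bsub>M\<^esub> (s \<odot>\<^bsub>M\<^esub> n))}"

definition localized_module ::
    "('r, 'k) ring_scheme \<Rightarrow> ('r, 'a) module \<Rightarrow> 'r set \<Rightarrow> ('a \<times> 'r) set set" where
  "localized_module R M P = (carrier M \<times> (carrier R - P)) // localization_rel R M P"

definition localized_zero ::
    "('r, 'k) ring_scheme \<Rightarrow> ('r, 'a) module \<Rightarrow> 'r set \<Rightarrow> ('a \<times> 'r) set" where
  "localized_zero R M P = localization_rel R M P `` {(\<zero>\<^bsub>M\<^esub>, \<one>\<^bsub>R\<^esub>)}"

definition module_support :: "('r, 'k) ring_scheme \<Rightarrow> ('r, 'a) module \<Rightarrow> 'r set set" where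
  "module_support R M = {P. primeideal P R \<and> localized_module R M P \<noteq> {localized_zero R M P}}"

definition associated_primes :: "('r, 'k) ring_scheme \<Rightarrow> ('r, 'a) module \<Rightarrow> 'r set set" where
  "associated_primes R M = {P. primeideal P R \<and>
     (\<exists>m \<in> carrier M. P = {r \<in> carrier R. r \<odot>\<^bsub>M\<^esub> m = \<zero>\<^bsub>M\<^esub>})}"

text \<open>The codimension of a prime is its height.\<close>

definition codimension :: "('r, 'k) ring_scheme \<Rightarrow> 'r set \<Rightarrow> enat" where
  "codimension R P = Sup {enat n | n. \<exists>Q :: nat \<Rightarrow> 'r set.
     (\<forall>j\<le>n. primeideal (Q j) R) \<and> (\<forall>j<n. Q j \<subset> Q (Suc j)) \<and> Q n = P}"


section \<open>The cellular complex\<close>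

text \<open>Polynomials in variables indexed by \<open>'n\<close>, as finitely supported functions on monomials.\<close>

type_synonym 'n poly_alg = "('n \<Rightarrow>\<^sub>0 nat) \<Rightarrow>\<^sub>0 rat"

abbreviation polynomial_ring :: "('n::finite poly_alg) ring" where
  "polynomial_ring \<equiv> ring_of_type_algebra"

definition linear_form :: "rat ^ 'n::finite \<Rightarrow> 'n poly_alg" where
  "linear_form a = (\<Sum>i\<in>UNIV. Poly_Mapping.single (Poly_Mapping.single i 1) (vec_nth a i))"

definition linear_prime :: "('n::finite poly_alg) set \<Rightarrow> bool" where
  "linear_prime P \<longleftrightarrow> (\<exists>A. P = Idl\<^bsub>polynomial_ring\<^esub> (linear_form ` A))"

definition cone_ideal :: "(rat ^ 'n::finite) set \<Rightarrow> ('n poly_alg) set" where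
  "cone_ideal \<xi> = Idl\<^bsub>polynomial_ring\<^esub> (linear_form ` {a. \<forall>x \<in> vec.span \<xi>. dot a x = 0})"

definition cone_module ::
    "(rat ^ 'n::finite) set \<Rightarrow> ('n poly_alg, ('n poly_alg) set) module" where
  "cone_module \<xi> = quotient_module (regular_module polynomial_ring) (cone_ideal \<xi>)"

definition chain_cones :: "(rat ^ 'n::finite) set set \<Rightarrow> nat \<Rightarrow> (rat ^ 'n) set set" where
  "chain_cones \<Sigma> k = (if 1 \<le> k \<and> k \<le> CARD('n) then interior_cones \<Sigma> k else {})"

definition chain_module :: "(rat ^ 'n::finite) set set \<Rightarrow> nat \<Rightarrow>
    ('n poly_alg, (rat ^ 'n) set \<Rightarrow> ('n poly_alg) set) module" where
  "chain_module \<Sigma> k = direct_sum_module (chain_cones \<Sigma> k) cone_module"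

text \<open>The map \<open>C\<^sub>k \<rightarrow> C\<^sub>k\<^sub>-\<^sub>1\<close>. Here \<open>X \<mapsto> I\<^sub>\<beta> + X\<close> is the canonical projection
  \<open>S/I\<^sub>\<alpha> \<rightarrow> S/I\<^sub>\<beta>\<close>, and \<open>single 0 q\<close> is the constant polynomial \<open>q\<close>. The argument \<open>k = 0\<close> is
  irrelevant, as \<open>C\<^sub>0 = 0\<close>.\<close>

definition boundary_map ::
    "((rat ^ 'n::finite) set \<Rightarrow> (rat ^ 'n) list) \<Rightarrow> (rat ^ 'n) set set \<Rightarrow> nat \<Rightarrow>
     ((rat ^ 'n) set \<Rightarrow> ('n poly_alg) set) \<Rightarrow> (rat ^ 'n) set \<Rightarrow> ('n poly_alg) set" where
  "boundary_map ori \<Sigma> k f = (\<lambda>\<beta> \<in> chain_cones \<Sigma> (k - 1).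
     (\<Oplus>\<^bsub>cone_module \<beta>\<^esub> \<alpha> \<in> {\<alpha> \<in> chain_cones \<Sigma> k. is_face \<beta> \<alpha>}.
        Poly_Mapping.single 0 (incidence ori \<alpha> \<beta>)
          \<odot>\<^bsub>cone_module \<beta>\<^esub> (cone_ideal \<beta> <+>\<^bsub>polynomial_ring\<^esub> f \<alpha>)))"

definition homology_module ::
    "((rat ^ 'n::finite) set \<Rightarrow> (rat ^ 'n) list) \<Rightarrow> (rat ^ 'n) set set \<Rightarrow> nat \<Rightarrow>
     ('n poly_alg, ((rat ^ 'n) set \<Rightarrow> ('n poly_alg) set) set) module" where
  "homology_module ori \<Sigma> k = quotient_module
     ((chain_module \<Sigma> k)
        \<lparr>carrier := a_kernel (chain_module \<Sigma> k) (chain_module \<Sigma> (k - 1)) (boundary_map ori \<Sigma> k)\<rparr>)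
     (boundary_map ori \<Sigma> (k + 1) ` carrier (chain_module \<Sigma> (k + 1)))"

end

theory Submission
  imports Defs
begin

text \<open>
  Write \<open>d\<close> for the dimension and \<open>L\<close> for the space of linear forms contained in a prime \<open>P\<close>. Both
  claims follow from one fact: if \<open>P\<close> lies in the support of the homology in degree \<open>d - i\<close>, or is
  associated to it, then \<open>dim L \<ge> i + 1\<close>.

  This fact bounds the codimension, because \<open>i + 1\<close> independent forms in \<open>P\<close> generate a strictly
  increasing chain of \<open>i + 2\<close> linear primes, starting with zero and contained in \<open>P\<close>. If the
  codimension is exactly \<open>i + 1\<close>, then \<open>P\<close> must be the last prime of that chain, hence linear. See
  \<open>linear_ideal_prime\<close> and \<open>codimension_ge_linear_forms\<close>.

  For the fact itself, assume \<open>dim L \<le> i\<close> and localize the complex at \<open>P\<close>. The summand of a cone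
  \<open>\<xi>\<close> survives only if \<open>I\<^sub>\<xi> \<subseteq> P\<close>, that is, if all forms vanishing on \<open>\<xi>\<close> lie in \<open>L\<close>. For a cone of
  dimension \<open>d - i\<close> these forms span a space of dimension \<open>i\<close>, so it must equal \<open>L\<close>: all surviving
  cones in degree \<open>d - i\<close> have one and the same linear span. Each of them is a facet of a cone of
  dimension \<open>d - i + 1\<close> (\<open>fan_cover_exists\<close>), since it lies in a \<open>d\<close>-dimensional one and \<open>i \<ge> 1\<close>;
  this cone is again interior, and has no other facet with the same span
  (\<open>face_eqI_vanishing_forms\<close>). So the localized differential into degree \<open>d - i\<close> hits every
  generator up to a nonzero incidence number and is surjective: already all chains are boundaries
  after localization, and the homology vanishes. The proof carries this out without localizing
  modules, by multiplying a chain with one suitable element outside \<open>P\<close>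
  (\<open>chain_locally_boundary\<close>, \<open>locally_zero_quotient\<close>).
\<close>

section \<open>Substitution in polynomial rings\<close>

lemma ring_of_type_algebra_sel [simp]:
  "carrier ring_of_type_algebra = UNIV"
  "x \<otimes>\<^bsub>ring_of_type_algebra\<^esub> y = x * y"
  "\<one>\<^bsub>ring_of_type_algebra\<^esub> = 1"
  "\<zero>\<^bsub>ring_of_type_algebra\<^esub> = 0"
  "x \<oplus>\<^bsub>ring_of_type_algebra\<^esub> y = x + y"
  by (simp_all add: ring_of_type_algebra_def)

interpretation poly_ring: cring "polynomial_ring :: ('n::finite poly_alg) ring"
  by (rule cring_from_type_algebra)

lemma minus_polynomial_ring [simp]: "\<ominus>\<^bsub>polynomial_ring\<^esub> (x :: 'n::finite poly_alg) = - x"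
  using poly_ring.minus_equality[of "- x" x] by simp

lemma polynomial_idealD:
  assumes "ideal I (polynomial_ring :: ('n::finite poly_alg) ring)"
  shows "0 \<in> I" "a \<in> I \<Longrightarrow> b \<in> I \<Longrightarrow> a + b \<in> I" "a \<in> I \<Longrightarrow> r * a \<in> I"
    "a \<in> I \<Longrightarrow> a * r \<in> I"
    "a \<in> I \<Longrightarrow> b \<in> I \<Longrightarrow> a - b \<in> I" "a \<in> I \<Longrightarrow> - a \<in> I"
proof -
  interpret ideal I polynomial_ring by fact
  show 1: "0 \<in> I" "a \<in> I \<Longrightarrow> b \<in> I \<Longrightarrow> a + b \<in> I" and 2: "a \<in> I \<Longrightarrow> r * a \<in> I" for a b r
    using zero_closed a_closed[of a b] I_l_closed[of a r] by auto
  then show "a \<in> I \<Longrightarrow> a * r \<in> I" by (simp add: mult.commute)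
  have 3: "- x \<in> I" if "x \<in> I" for x using 2[of x "-1"] that by simp
  then show "a \<in> I \<Longrightarrow> - a \<in> I" .
  show "a \<in> I \<Longrightarrow> b \<in> I \<Longrightarrow> a - b \<in> I" using 1(2)[of a "- b"] 3[of b] by simp
qed

lemma polynomial_idealI:
  assumes "0 \<in> I" "\<And>a b. a \<in> I \<Longrightarrow> b \<in> I \<Longrightarrow> a + b \<in> I" "\<And>a r. a \<in> I \<Longrightarrow> r * a \<in> I"
  shows "ideal I (polynomial_ring :: ('n::finite poly_alg) ring)"
proof (rule idealI)
  show "subgroup I (add_monoid polynomial_ring)"
  proof
    show "inv\<^bsub>add_monoid polynomial_ring\<^esub> x \<in> I" if "x \<in> I" for x
      using assms(3)[of x "-1"] that minus_polynomial_ring[of x]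
      by (simp add: a_inv_def)
  qed (use assms in auto)
qed (use assms in \<open>auto simp: mult.commute poly_ring.ring_axioms\<close>)

text \<open>The \<open>\<rat>\<close>-linear extension of a map on monomials. Source and target may have different index
  types: substitutions of polynomials for variables and the renaming of variables by natural
  numbers are both instances.\<close>

definition eval_monomials ::
    "('k \<Rightarrow> ('a::comm_monoid_add \<Rightarrow>\<^sub>0 rat)) \<Rightarrow> ('k \<Rightarrow>\<^sub>0 rat) \<Rightarrow> ('a \<Rightarrow>\<^sub>0 rat)" where
  "eval_monomials h f =
     (\<Sum>m\<in>Poly_Mapping.keys f. Poly_Mapping.single 0 (Poly_Mapping.lookup f m) * h m)"

lemma eval_monomials_add: "eval_monomials h (f + g) = eval_monomials h f + eval_monomials h g"
  unfolding eval_monomials_def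
  by (rule Poly_Mapping.setsum_keys_plus_distrib[where f = "\<lambda>k v. Poly_Mapping.single 0 v * h k"])
     (auto simp: Poly_Mapping.single_add distrib_right)

lemma eval_monomials_single:
  "eval_monomials h (Poly_Mapping.single m c) = Poly_Mapping.single 0 c * h m"
  by (cases "c = 0") (auto simp: eval_monomials_def)

lemma eval_monomials_sum: "eval_monomials h (\<Sum>i\<in>A. f i) = (\<Sum>i\<in>A. eval_monomials h (f i))"
  by (induction A rule: infinite_finite_induct)
     (auto simp: eval_monomials_add, simp_all add: eval_monomials_def)

lemma sum_single_lookup:
  "(\<Sum>m\<in>Poly_Mapping.keys f. Poly_Mapping.single m (Poly_Mapping.lookup f m)) = f"
  by (rule poly_mapping_eqI)
     (auto simp: lookup_sum lookup_single when_def sum.delta' in_keys_iff)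

lemma eval_monomials_mult:
  assumes h: "\<And>m n. h (m + n) = h m * h n"
  shows "eval_monomials h (f * g) = eval_monomials h f * eval_monomials h g"
proof -
  have "f * g = (\<Sum>m\<in>Poly_Mapping.keys f. Poly_Mapping.single m (Poly_Mapping.lookup f m)) *
     (\<Sum>m\<in>Poly_Mapping.keys g. Poly_Mapping.single m (Poly_Mapping.lookup g m))"
    by (simp only: sum_single_lookup)
  also have "\<dots> = (\<Sum>m\<in>Poly_Mapping.keys f. \<Sum>n\<in>Poly_Mapping.keys g.
      Poly_Mapping.single (m + n) (Poly_Mapping.lookup f m * Poly_Mapping.lookup g n))"
    by (simp add: sum_product mult_single)
  finally have "eval_monomials h (f * g) = (\<Sum>m\<in>Poly_Mapping.keys f. \<Sum>n\<in>Poly_Mapping.keys g.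
      Poly_Mapping.single 0 (Poly_Mapping.lookup f m * Poly_Mapping.lookup g n) * h (m + n))"
    by (simp add: eval_monomials_sum eval_monomials_single)
  also have "\<dots> = (\<Sum>m\<in>Poly_Mapping.keys f. \<Sum>n\<in>Poly_Mapping.keys g.
      (Poly_Mapping.single 0 (Poly_Mapping.lookup f m) * h m) *
      (Poly_Mapping.single 0 (Poly_Mapping.lookup g n) * h n))"
  proof (intro sum.cong refl)
    fix m n
    have "Poly_Mapping.single 0 (Poly_Mapping.lookup f m * Poly_Mapping.lookup g n) =
       Poly_Mapping.single (0::'b) (Poly_Mapping.lookup f m) * Poly_Mapping.single 0 (Poly_Mapping.lookup g n)"
      by (simp add: mult_single)
    then show "Poly_Mapping.single 0 (Poly_Mapping.lookup f m * Poly_Mapping.lookup g n) * h (m + n)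
      = (Poly_Mapping.single 0 (Poly_Mapping.lookup f m) * h m) *
      (Poly_Mapping.single 0 (Poly_Mapping.lookup g n) * h n)"
      by (simp only: h ac_simps)
  qed
  also have "\<dots> = eval_monomials h f * eval_monomials h g"
    by (simp only: eval_monomials_def sum_product)
  finally show ?thesis .
qed

lemma prod_single_one:
  "(\<Prod>i\<in>A. Poly_Mapping.single (u i) (1::rat)) = Poly_Mapping.single (\<Sum>i\<in>A. u i :: 'a::comm_monoid_add) 1"
  by (induction A rule: infinite_finite_induct) (auto simp: mult_single)

lemma power_single_one:
  "Poly_Mapping.single (Poly_Mapping.single i (a::nat)) (1::rat) ^ n =
     Poly_Mapping.single (Poly_Mapping.single i (a * n)) 1"
  by (induction n) (auto simp: mult_single single_add[symmetric])

lemma sum_single_lookup_UNIV: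
  fixes m :: "'n::finite \<Rightarrow>\<^sub>0 nat"
  shows "(\<Sum>i\<in>UNIV. Poly_Mapping.single i (Poly_Mapping.lookup m i)) = m"
  by (rule poly_mapping_eqI) (auto simp: lookup_sum lookup_single when_def)

definition substitute ::
    "('n::finite \<Rightarrow> ('a::comm_monoid_add \<Rightarrow>\<^sub>0 rat)) \<Rightarrow> 'n poly_alg \<Rightarrow> ('a \<Rightarrow>\<^sub>0 rat)" where
  "substitute x = eval_monomials (\<lambda>m. \<Prod>i\<in>UNIV. x i ^ Poly_Mapping.lookup m i)"

lemma substitute_add: "substitute x (f + g) = substitute x f + substitute x g"
  by (simp add: substitute_def eval_monomials_add)

lemma substitute_sum: "substitute x (\<Sum>i\<in>A. f i) = (\<Sum>i\<in>A. substitute x (f i))"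
  by (simp add: substitute_def eval_monomials_sum)

lemma substitute_mult: "substitute x (f * g) = substitute x f * substitute x g"
  unfolding substitute_def
  by (rule eval_monomials_mult) (simp add: lookup_add power_add prod.distrib)

lemma substitute_zero: "substitute x 0 = 0"
  by (simp add: substitute_def eval_monomials_def)

lemma substitute_one: "substitute x 1 = 1"
  using eval_monomials_single[of "\<lambda>m. \<Prod>i\<in>UNIV. x i ^ Poly_Mapping.lookup m i" 0 1]
  by (simp add: substitute_def)

lemma substitute_single:
  "substitute x (Poly_Mapping.single m c) =
     Poly_Mapping.single 0 c * (\<Prod>i\<in>UNIV. x i ^ Poly_Mapping.lookup m i)"
  by (simp add: substitute_def eval_monomials_single)

lemma substitute_variable:
  "substitute x (Poly_Mapping.single (Poly_Mapping.single i 1) c) = Poly_Mapping.single 0 c * x i"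
proof -
  have "(\<Prod>j\<in>UNIV. x j ^ Poly_Mapping.lookup (Poly_Mapping.single i 1) j) =
     (\<Prod>j\<in>UNIV. if j = i then x i else 1)"
    by (intro prod.cong) (auto simp: lookup_single when_def)
  then show ?thesis by (simp add: substitute_single)
qed

lemma substitute_linear_form:
  "substitute x (linear_form a) = (\<Sum>i\<in>UNIV. Poly_Mapping.single 0 (vec_nth a i) * x i)"
  unfolding linear_form_def substitute_sum by (simp only: substitute_variable)

text \<open>If every variable agrees with its substitute modulo \<open>I\<close>, then so does every polynomial,
  because congruence modulo an ideal respects sums and products. This is what bounds the kernel
  of a substitution from above.\<close>

lemma substitute_congruence:
  fixes x :: "'n::finite \<Rightarrow> 'n poly_alg"
  assumes I: "ideal I polynomial_ring"
    and x: "\<And>i. Poly_Mapping.single (Poly_Mapping.single i 1) 1 - x i \<in> I"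
  shows "f - substitute x f \<in> I"
proof -
  have mult: "a * b - a' * b' \<in> I" if "a - a' \<in> I" "b - b' \<in> I" for a b a' b'
  proof -
    have "a * b - a' * b' = b * (a - a') + a' * (b - b')" by (simp add: algebra_simps)
    then show ?thesis using polynomial_idealD[OF I] that by metis
  qed
  have pow: "a ^ k - b ^ k \<in> I" if "a - b \<in> I" for a b and k :: nat
    by (induction k) (use that in \<open>simp_all add: mult polynomial_idealD(1)[OF I]\<close>)
  have prod: "(\<Prod>i\<in>A. u i) - (\<Prod>i\<in>A. v i) \<in> I" if "\<And>i. u i - v i \<in> I" for u v and A :: "'n set"
    by (induction A rule: infinite_finite_induct)
       (use that in \<open>simp_all add: mult polynomial_idealD(1)[OF I]\<close>)
  have sum: "(\<Sum>i\<in>A. u i) - (\<Sum>i\<in>A. v i) \<in> I" if "\<And>i. u i - v i \<in> I"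
    for u v and A :: "('n \<Rightarrow>\<^sub>0 nat) set"
  proof -
    have "(\<Sum>i\<in>A. u i - v i) \<in> I"
      by (induction A rule: infinite_finite_induct)
         (use that in \<open>simp_all add: polynomial_idealD(1,2)[OF I]\<close>)
    then show ?thesis by (simp add: sum_subtractf)
  qed
  have mono: "Poly_Mapping.single m c - Poly_Mapping.single 0 c * (\<Prod>i\<in>UNIV. x i ^ Poly_Mapping.lookup m i) \<in> I"
    for m c
  proof -
    have "Poly_Mapping.single m c = Poly_Mapping.single 0 c *
       (\<Prod>i\<in>UNIV. Poly_Mapping.single (Poly_Mapping.single i 1) 1 ^ Poly_Mapping.lookup m i)"
      by (simp only: power_single_one prod_single_one mult_1 sum_single_lookup_UNIV)
         (simp add: mult_single)
    moreover have "(\<Prod>i\<in>UNIV. Poly_Mapping.single (Poly_Mapping.single i 1) 1 ^ Poly_Mapping.lookup m i)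
        - (\<Prod>i\<in>UNIV. x i ^ Poly_Mapping.lookup m i) \<in> I"
      by (intro prod pow x)
    ultimately show ?thesis
      using polynomial_idealD(3)[OF I] by (simp only: right_diff_distrib[symmetric])
  qed
  have "(\<Sum>m\<in>Poly_Mapping.keys f. Poly_Mapping.single m (Poly_Mapping.lookup f m)) - substitute x f \<in> I"
    unfolding substitute_def eval_monomials_def by (rule sum) (rule mono)
  then show ?thesis by (simp only: sum_single_lookup)
qed

text \<open>Renaming the variables injectively loses no coefficient, since distinct monomials go to
  distinct monomials.\<close>

lemma substitute_distinct_variables_eq_0:
  fixes e :: "'n::finite \<Rightarrow> 'k"
  assumes e: "inj e"
    and f: "substitute (\<lambda>i. Poly_Mapping.single (Poly_Mapping.single (e i) (1::nat)) 1) f = 0"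
  shows "f = 0"
proof (rule poly_mapping_eqI)
  \<comment> \<open>The renaming of the variables of a monomial.\<close>
  define rn where "rn m = (\<Sum>i\<in>UNIV. Poly_Mapping.single (e i) (Poly_Mapping.lookup m i))"
    for m :: "'n \<Rightarrow>\<^sub>0 nat"
  have rn: "Poly_Mapping.lookup (rn m) (e i) = Poly_Mapping.lookup m i" for m i
  proof -
    have "Poly_Mapping.lookup (rn m) (e i) = (\<Sum>j\<in>UNIV. if j = i then Poly_Mapping.lookup m j else 0)"
      unfolding rn_def lookup_sum lookup_single
      by (intro sum.cong) (use e in \<open>auto simp: when_def inj_def\<close>)
    then show ?thesis by simp
  qed
  have inj: "rn m = rn n \<longleftrightarrow> m = n" for m n
    by (metis rn poly_mapping_eqI)
  fix m
  have "0 = substitute (\<lambda>i. Poly_Mapping.single (Poly_Mapping.single (e i) (1::nat)) 1) f"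
    using f by simp
  also have "\<dots> = (\<Sum>k\<in>Poly_Mapping.keys f. Poly_Mapping.single (rn k) (Poly_Mapping.lookup f k))"
    unfolding substitute_def eval_monomials_def power_single_one prod_single_one
    by (simp add: mult_single rn_def)
  finally have "0 = Poly_Mapping.lookup
      (\<Sum>k\<in>Poly_Mapping.keys f. Poly_Mapping.single (rn k) (Poly_Mapping.lookup f k)) (rn m)"
    by (metis lookup_zero)
  also have "\<dots> = (\<Sum>k\<in>Poly_Mapping.keys f. if k = m then Poly_Mapping.lookup f k else 0)"
    unfolding lookup_sum lookup_single by (intro sum.cong) (auto simp: when_def inj)
  also have "\<dots> = Poly_Mapping.lookup f m"
    by (simp add: in_keys_iff)
  finally show "Poly_Mapping.lookup f m = Poly_Mapping.lookup 0 m" by simp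
qed

text \<open>The usual proof compares leading monomials, which requires an order on the monomials, and the
  finite index type carries none. Renaming the variables by natural numbers embeds the ring into
  one whose monomials are linearly ordered.\<close>

lemma poly_alg_no_zero_divisors:
  fixes f g :: "'n::finite poly_alg"
  assumes "f * g = 0"
  shows "f = 0 \<or> g = 0"
proof -
  obtain e :: "'n \<Rightarrow> nat" where e: "inj e"
    using finite_imp_inj_to_nat_seg[of "UNIV :: 'n set"] by auto
  define F where "F = substitute (\<lambda>i. Poly_Mapping.single (Poly_Mapping.single (e i) (1::nat)) 1)"
  have "F f * F g = 0"
    using assms by (metis F_def substitute_mult substitute_zero)
  then have "F f = 0 \<or> F g = 0" by simp
  then show ?thesis
    using substitute_distinct_variables_eq_0[OF e] unfolding F_def by blast
qed

section \<open>Ideals generated by linear forms\<close>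

lemma lookup_linear_form:
  "Poly_Mapping.lookup (linear_form a) (Poly_Mapping.single i 1) = vec_nth a i"
proof -
  have "Poly_Mapping.lookup (linear_form a) (Poly_Mapping.single i 1) =
    (\<Sum>j\<in>UNIV. if j = i then vec_nth a j else 0)"
    unfolding linear_form_def lookup_sum lookup_single
  proof (intro sum.cong refl)
    fix j
    show "(vec_nth a j when Poly_Mapping.single j (1::nat) = Poly_Mapping.single i 1) =
      (if j = i then vec_nth a j else 0)"
      by (metis (mono_tags) when_def lookup_single_eq lookup_single_not_eq one_neq_zero)
  qed
  then show ?thesis by simp
qed

lemma linear_form_eq_0_iff [simp]: "linear_form a = 0 \<longleftrightarrow> a = 0"
proof
  assume "linear_form a = 0"
  then have "vec_nth a i = 0" for i using lookup_linear_form[of a i] by simp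
  then show "a = 0" by (simp add: Finite_Cartesian_Product.vec_eq_iff)
qed (simp add: linear_form_def)

lemma linear_form_zero: "linear_form 0 = 0"
  by simp

lemma linear_form_add: "linear_form (a + b) = linear_form a + linear_form b"
  by (simp add: linear_form_def single_add sum.distrib)

lemma linear_form_scale: "linear_form (c *s a) = Poly_Mapping.single 0 c * linear_form a"
  by (simp add: linear_form_def sum_distrib_left mult_single)

lemma linear_form_sum: "linear_form (\<Sum>i\<in>A. f i) = (\<Sum>i\<in>A. linear_form (f i))"
  by (induction A rule: infinite_finite_induct) (auto simp: linear_form_add)

lemma linear_form_diff: "linear_form (a - b) = linear_form a - linear_form b"
  using linear_form_add[of "a - b" b] by simp

lemma linear_form_axis: "linear_form (axis i 1) = Poly_Mapping.single (Poly_Mapping.single i 1) 1"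
proof -
  have "linear_form (axis i 1) =
     (\<Sum>j\<in>UNIV. if j = i then Poly_Mapping.single (Poly_Mapping.single i 1) 1 else 0)"
    unfolding linear_form_def by (intro sum.cong) (auto simp: axis_def)
  then show ?thesis by simp
qed

definition linear_forms_in :: "('n::finite poly_alg) set \<Rightarrow> (rat ^ 'n) set" where
  "linear_forms_in P = {a. linear_form a \<in> P}"

lemma subspace_linear_forms_in:
  assumes "ideal P polynomial_ring"
  shows "vec.subspace (linear_forms_in P)"
  unfolding vec.subspace_def linear_forms_in_def
  by (auto simp: linear_form_add linear_form_scale linear_form_zero
      intro: polynomial_idealD[OF assms])

text \<open>A projection along \<open>L\<close> onto a complement: extend a basis of \<open>L\<close> and kill its elements.\<close>

lemma projection_with_kernel:
  fixes L :: "(rat ^ 'n::finite) set"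
  assumes L: "vec.subspace L"
  obtains T :: "rat ^ 'n \<Rightarrow> rat ^ 'n" where "Vector_Spaces.linear (*s) (*s) T" "\<And>a. a \<in> L \<Longrightarrow> T a = 0" "\<And>a. a - T a \<in> L"
proof -
  obtain B where B: "B \<subseteq> L" "vec.independent B" "L \<subseteq> vec.span B"
    using vec.basis_exists by metis
  define B' where "B' = vec.extend_basis B"
  have B': "B \<subseteq> B'" "vec.independent B'" "vec.span B' = UNIV"
    using vec.extend_basis_superset vec.independent_extend_basis vec.span_extend_basis B(2)
    unfolding B'_def by blast+
  obtain T where T: "Vector_Spaces.linear (*s) (*s) T" "\<forall>x\<in>B'. T x = (if x \<in> B then 0 else x)"
    using vec.linear_independent_extend[OF B'(2), of "\<lambda>x. if x \<in> B then 0 else x"] by auto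
  interpret T: Vector_Spaces.linear "(*s)" "(*s)" T by fact
  have "T a = 0" if "a \<in> L" for a
  proof (rule T.eq_0_on_span)
    show "a \<in> vec.span B" using B that by auto
  qed (use T(2) B' in auto)
  moreover have "a - T a \<in> L" for a
  proof -
    have "a \<in> vec.span B'" using B' by simp
    then show ?thesis
    proof (induction rule: vec.span_induct_alt)
      case base show ?case using vec.subspace_0[OF L] by simp
    next
      case (step c x y)
      have "x - T x \<in> L" using T(2) step B vec.subspace_0[OF L] by auto
      moreover have "c *s x + y - T (c *s x + y) = c *s (x - T x) + (y - T y)"
        by (simp add: T.add T.scale vector_ssub_ldistrib algebra_simps)
      moreover have "c *s (x - T x) + (y - T y) \<in> L"
        using calculation(1) step(2) by (intro vec.subspace_add vec.subspace_scale L)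
      ultimately show ?case by metis
    qed
  qed
  ultimately show ?thesis using T(1) that by blast
qed

lemma substitute_linear_form_linear:
  fixes T :: "rat ^ 'n::finite \<Rightarrow> rat ^ 'n"
  assumes "Vector_Spaces.linear (*s) (*s) T"
  shows "substitute (\<lambda>i. linear_form (T (axis i 1))) (linear_form a) = linear_form (T a)"
proof -
  interpret T: Vector_Spaces.linear "(*s)" "(*s)" T by fact
  have "a = (\<Sum>i\<in>UNIV. vec_nth a i *s axis i 1)" by (simp add: basis_expansion)
  then have "T a = (\<Sum>i\<in>UNIV. vec_nth a i *s T (axis i 1))"
    by (metis (no_types, lifting) T.scale T.sum sum.cong)
  then show ?thesis
    by (simp add: substitute_linear_form linear_form_sum linear_form_scale)
qed

text \<open>Substituting \<open>T x\<^sub>i\<close> for \<open>x\<^sub>i\<close>, with \<open>T\<close> a projection along \<open>L\<close>, restricts polynomials to the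
  linear space cut out by \<open>L\<close>. The kernel contains \<open>L\<close>, and it is no larger than the ideal
  generated by \<open>L\<close> because each \<open>x\<^sub>i - T x\<^sub>i\<close> lies in \<open>L\<close>.\<close>

lemma linear_ideal_eq_kernel:
  fixes L :: "(rat ^ 'n::finite) set"
  assumes T: "Vector_Spaces.linear (*s) (*s) T" "\<And>a. a \<in> L \<Longrightarrow> T a = 0" "\<And>a. a - T a \<in> L"
  shows "Idl\<^bsub>polynomial_ring\<^esub> (linear_form ` L) =
    {f. substitute (\<lambda>i. linear_form (T (axis i 1))) f = 0}" (is "?I = {f. ?S f = 0}")
proof
  have I: "ideal ?I polynomial_ring" by (rule poly_ring.genideal_ideal) simp
  have sub: "linear_form ` L \<subseteq> ?I" by (rule poly_ring.genideal_self) simp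
  have "ideal {f. ?S f = 0} polynomial_ring"
    by (rule polynomial_idealI) (auto simp: substitute_add substitute_mult substitute_zero)
  moreover have "linear_form ` L \<subseteq> {f. ?S f = 0}"
    using T(2) substitute_linear_form_linear[OF T(1)] by auto
  ultimately show "?I \<subseteq> {f. ?S f = 0}" by (rule poly_ring.genideal_minimal)
  have "Poly_Mapping.single (Poly_Mapping.single i 1) 1 - linear_form (T (axis i 1)) \<in> ?I" for i
  proof -
    have "linear_form (axis i 1 - T (axis i 1)) \<in> ?I" using T(3)[of "axis i 1"] sub by blast
    then show ?thesis by (simp only: linear_form_diff linear_form_axis)
  qed
  then have cong: "f - ?S f \<in> ?I" for f by (rule substitute_congruence[OF I])
  show "{f. ?S f = 0} \<subseteq> ?I"
  proof
    fix f assume "f \<in> {f. ?S f = 0}"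
    then have "?S f = 0" by simp
    then show "f \<in> ?I" using cong[of f] by simp
  qed
qed

text \<open>The quotient by the ideal embeds into the polynomial ring, a domain, by the substitution above.\<close>

lemma linear_ideal_prime:
  fixes L :: "(rat ^ 'n::finite) set"
  assumes L: "vec.subspace L"
  shows "primeideal (Idl\<^bsub>polynomial_ring\<^esub> (linear_form ` L)) polynomial_ring"
proof -
  let ?I = "Idl\<^bsub>polynomial_ring\<^esub> (linear_form ` L)"
  have I: "ideal ?I polynomial_ring" by (rule poly_ring.genideal_ideal) simp
  obtain T where T: "Vector_Spaces.linear (*s) (*s) T" "\<And>a. a \<in> L \<Longrightarrow> T a = 0" "\<And>a. a - T a \<in> L"
    using projection_with_kernel[OF L] by blast
  note ker = linear_ideal_eq_kernel[OF T]
  show ?thesis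
  proof (rule primeidealI[OF I poly_ring.is_cring])
    have "1 \<notin> ?I" by (simp add: ker substitute_one)
    then show "carrier polynomial_ring \<noteq> ?I" by auto
  next
    fix a b assume "a \<otimes>\<^bsub>polynomial_ring\<^esub> b \<in> ?I"
    then show "a \<in> ?I \<or> b \<in> ?I"
      using poly_alg_no_zero_divisors by (auto simp: ker substitute_mult)
  qed
qed

text \<open>No further linear forms enter the generated ideal, since the projection kills exactly the
  elements of \<open>L\<close>. Hence strict inclusions of spaces of forms give strict inclusions of primes.\<close>

lemma linear_forms_in_linear_ideal:
  fixes L :: "(rat ^ 'n::finite) set"
  assumes L: "vec.subspace L"
  shows "linear_forms_in (Idl\<^bsub>polynomial_ring\<^esub> (linear_form ` L)) = L"
proof -
  obtain T where T: "Vector_Spaces.linear (*s) (*s) T" "\<And>a. a \<in> L \<Longrightarrow> T a = 0" "\<And>a. a - T a \<in> L"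
    using projection_with_kernel[OF L] by blast
  have "T a = 0 \<longleftrightarrow> a \<in> L" for a using T(2)[of a] T(3)[of a] by auto
  then show ?thesis
    by (simp add: linear_forms_in_def linear_ideal_eq_kernel[OF T] substitute_linear_form_linear[OF T(1)])
qed

lemma le_codimension:
  assumes "\<And>j. j \<le> n \<Longrightarrow> primeideal (Q j) R" "\<And>j. j < n \<Longrightarrow> Q j \<subset> Q (Suc j)" "Q n = P"
  shows "enat n \<le> codimension R P"
  unfolding codimension_def by (rule Sup_upper) (use assms in blast)

text \<open>Independent forms \<open>b\<^sub>0, b\<^sub>1, \<dots>\<close> in \<open>P\<close> generate primes \<open>0 \<subset> (b\<^sub>0) \<subset> (b\<^sub>0, b\<^sub>1) \<subset> \<dots>\<close> below \<open>P\<close>, which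
  bounds the height from below. If \<open>P\<close> were strictly larger than the prime generated by the first
  \<open>m\<close> of them, it would prolong that chain; so at height exactly \<open>m\<close> it is this linear prime.\<close>

lemma codimension_ge_linear_forms:
  fixes P :: "('n::finite poly_alg) set"
  assumes P: "primeideal P polynomial_ring"
    and m: "m \<le> vec.dim (linear_forms_in P)"
  shows "enat m \<le> codimension polynomial_ring P"
    and "codimension polynomial_ring P = enat m \<Longrightarrow> linear_prime P"
proof -
  let ?J = "\<lambda>L. Idl\<^bsub>polynomial_ring\<^esub> (linear_form ` L)"
  obtain B where B: "B \<subseteq> linear_forms_in P" "vec.independent B" "card B = vec.dim (linear_forms_in P)"
    using vec.basis_exists by metis
  then have "finite B" using vec.finiteI_independent by blast
  then obtain b where b: "bij_betw b {..<card B} B"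
    by (metis lessThan_atLeast0 ex_bij_betw_nat_finite)
  define V where "V j = vec.span (b ` {..<j})" for j
  have V: "vec.subspace (V j)" for j by (simp add: V_def)
  have prime: "primeideal (?J (V j)) polynomial_ring" for j by (rule linear_ideal_prime[OF V])
  have sub: "?J (V j) \<subseteq> P" if "j \<le> m" for j
  proof (rule poly_ring.genideal_minimal)
    show idl: "ideal P polynomial_ring" using P by (rule primeideal.axioms(1))
    have "b ` {..<j} \<subseteq> linear_forms_in P"
      using b B(1,3) m that by (auto simp: bij_betw_def)
    then have "V j \<subseteq> linear_forms_in P"
      unfolding V_def by (rule vec.span_minimal[OF _ subspace_linear_forms_in[OF idl]])
    then show "linear_form ` V j \<subseteq> P" by (auto simp: linear_forms_in_def)
  qed
  have new: "b j \<notin> V j" if "j < m" for j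
  proof
    assume "b j \<in> V j"
    moreover have "j < card B" using that m B by simp
    moreover have "b ` {..<j} \<subseteq> B - {b j}"
    proof
      fix y assume "y \<in> b ` {..<j}"
      then obtain k where "k < j" "y = b k" by auto
      then show "y \<in> B - {b j}"
        using b \<open>j < card B\<close> by (auto simp: bij_betw_def inj_on_def)
    qed
    moreover have "b j \<in> B" using b \<open>j < card B\<close> by (auto simp: bij_betw_def)
    ultimately show False
      using B(2) vec.span_mono[of "b ` {..<j}" "B - {b j}"]
      by (auto simp: V_def vec.dependent_def)
  qed
  have mem: "linear_form a \<in> ?J (V j) \<longleftrightarrow> a \<in> V j" for a j
    using linear_forms_in_linear_ideal[OF V[of j]] by (auto simp: linear_forms_in_def)
  have newJ: "linear_form (b j) \<notin> ?J (V j)" if "j < m" for j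
    using new[OF that] mem by blast
  have step: "?J (V j) \<subset> ?J (V (Suc j))" if "j < m" for j
  proof
    have "V j \<subseteq> V (Suc j)" unfolding V_def by (intro vec.span_mono image_mono) auto
    then show "?J (V j) \<subseteq> ?J (V (Suc j))"
      by (intro poly_ring.genideal_minimal poly_ring.genideal_ideal)
         (auto intro!: subsetD[OF poly_ring.genideal_self])
    have "b j \<in> V (Suc j)" unfolding V_def by (rule vec.span_base) auto
    then show "?J (V j) \<noteq> ?J (V (Suc j))" using mem newJ[OF that] by metis
  qed
  show "enat m \<le> codimension polynomial_ring P"
  proof (rule le_codimension[where Q = "\<lambda>j. if j < m then ?J (V j) else P"])
    fix j assume "j < m"
    have "j < card B" using \<open>j < m\<close> m B(3) by simp
    then have "b j \<in> B" using b by (auto simp: bij_betw_def)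
    then have "linear_form (b j) \<in> P" using B(1) by (auto simp: linear_forms_in_def)
    then have "?J (V j) \<subset> P" using sub[of j] newJ[OF \<open>j < m\<close>] \<open>j < m\<close> by auto
    then show "(if j < m then ?J (V j) else P) \<subset> (if Suc j < m then ?J (V (Suc j)) else P)"
      using step[OF \<open>j < m\<close>] \<open>j < m\<close> by auto
  qed (use P prime in auto)
  assume cod: "codimension polynomial_ring P = enat m"
  have "?J (V m) = P"
  proof (rule ccontr)
    assume "?J (V m) \<noteq> P"
    then have "?J (V m) \<subset> P" using sub[of m] by auto
    then have "enat (Suc m) \<le> codimension polynomial_ring P"
      by (intro le_codimension[where Q = "\<lambda>j. if j \<le> m then ?J (V j) else P"])
         (use P prime step in \<open>auto simp: less_Suc_eq\<close>)
    then show False using cod by simp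
  qed
  then show "linear_prime P" unfolding linear_prime_def by metis
qed

section \<open>Linear forms vanishing on a cone\<close>

lemma dot_add_right: "dot u (x + y) = dot u x + dot u y"
  by (simp add: dot_def distrib_left sum.distrib)

lemma dot_add_left: "dot (u + v) x = dot u x + dot v x"
  by (simp add: dot_def distrib_right sum.distrib)

lemma dot_scale_right: "dot u (c *s x) = c * dot u x"
  by (simp add: dot_def sum_distrib_left mult.left_commute)

lemma dot_scale_left: "dot (c *s u) x = c * dot u x"
  by (simp add: dot_def sum_distrib_left mult.assoc)

lemma dot_diff_left: "dot (u - v) x = dot u x - dot v x"
  by (simp add: dot_def left_diff_distrib sum_subtractf)

lemma dot_zero [simp]: "dot 0 x = 0" "dot u 0 = 0"
  by (simp_all add: dot_def)

lemma dot_sum_right: "dot u (\<Sum>i\<in>A. f i) = (\<Sum>i\<in>A. dot u (f i))"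
  by (induction A rule: infinite_finite_induct) (auto simp: dot_add_right)

definition vanishing_forms :: "(rat ^ 'n::finite) set \<Rightarrow> (rat ^ 'n) set" where
  "vanishing_forms Y = {a. \<forall>x\<in>Y. dot a x = 0}"

lemma subspace_vanishing_forms: "vec.subspace (vanishing_forms Y)"
  by (auto simp: vec.subspace_def vanishing_forms_def dot_add_left dot_scale_left)

lemma vanishing_forms_span: "vanishing_forms (vec.span Y) = vanishing_forms Y"
proof
  show "vanishing_forms (vec.span Y) \<subseteq> vanishing_forms Y"
    by (auto simp: vanishing_forms_def intro: vec.span_base)
  have "vec.span Y \<subseteq> {x. dot a x = 0}" if "a \<in> vanishing_forms Y" for a
    by (rule vec.span_minimal)
       (use that in \<open>auto simp: vanishing_forms_def vec.subspace_def dot_add_right dot_scale_right\<close>)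
  then show "vanishing_forms Y \<subseteq> vanishing_forms (vec.span Y)"
    by (auto simp: vanishing_forms_def)
qed

text \<open>A coordinate of the projection along the span of \<open>Y\<close> that is nonzero at \<open>v\<close>.\<close>

lemma separating_form:
  fixes v :: "rat ^ 'n::finite"
  assumes "v \<notin> vec.span Y"
  obtains t where "t \<in> vanishing_forms Y" "dot t v \<noteq> 0"
proof -
  obtain T where T: "Vector_Spaces.linear (*s) (*s) T" "\<And>a. a \<in> vec.span Y \<Longrightarrow> T a = 0"
      "\<And>a. a - T a \<in> vec.span Y"
    using projection_with_kernel[OF vec.subspace_span[of Y]] by blast
  interpret T: Vector_Spaces.linear "(*s)" "(*s)" T by fact
  have "T v \<noteq> 0" using T(3)[of v] assms by auto
  then obtain k where k: "vec_nth (T v) k \<noteq> 0"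
    by (auto simp: Finite_Cartesian_Product.vec_eq_iff)
  define t where "t = (\<chi> i. vec_nth (T (axis i 1)) k)"
  have t: "dot t x = vec_nth (T x) k" for x
  proof -
    have "x = (\<Sum>i\<in>UNIV. vec_nth x i *s axis i 1)" by (simp add: basis_expansion)
    then have "T x = (\<Sum>i\<in>UNIV. vec_nth x i *s T (axis i 1))"
      by (metis (no_types, lifting) T.scale T.sum sum.cong)
    then show ?thesis by (simp add: dot_def t_def mult.commute)
  qed
  show ?thesis
  proof (rule that)
    show "t \<in> vanishing_forms Y"
      using T(2) by (auto simp: vanishing_forms_def t vec.span_base)
    show "dot t v \<noteq> 0" using k by (simp add: t)
  qed
qed

text \<open>Extend a basis of \<open>Y\<close> to a basis of the whole space. The dual basis vectors of the added
  elements vanish on \<open>Y\<close> and are independent.\<close>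

lemma dim_vanishing_forms:
  fixes Y :: "(rat ^ 'n::finite) set"
  shows "CARD('n) \<le> vec.dim (vanishing_forms Y) + vec.dim Y"
proof -
  obtain B where B: "B \<subseteq> Y" "vec.independent B" "Y \<subseteq> vec.span B" "card B = vec.dim Y"
    using vec.basis_exists by metis
  define B' where "B' = vec.extend_basis B"
  have B': "B \<subseteq> B'" "vec.independent B'" "vec.span B' = UNIV"
    using vec.extend_basis_superset vec.independent_extend_basis vec.span_extend_basis B(2)
    unfolding B'_def by blast+
  have fin: "finite B'" using B'(2) by (rule vec.finiteI_independent)
  have cardB': "card B' = CARD('n)"
    using vec.dim_eq_card[of B' UNIV] B' by (simp add: card_cart_basis)
  have "\<exists>t. t \<in> vanishing_forms (B' - {b}) \<and> dot t b \<noteq> 0" if "b \<in> B'" for b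
    using separating_form[of b "B' - {b}"] B'(2) that unfolding vec.dependent_def by metis
  then obtain t where t: "\<And>b. b \<in> B' \<Longrightarrow> t b \<in> vanishing_forms (B' - {b})" "\<And>b. b \<in> B' \<Longrightarrow> dot (t b) b \<noteq> 0"
    by metis
  have off: "dot (t b) c = 0" if "b \<in> B'" "c \<in> B'" "b \<noteq> c" for b c
    using t(1)[OF that(1)] that by (auto simp: vanishing_forms_def)
  have inj: "inj_on t (B' - B)"
  proof (rule inj_onI, rule ccontr)
    fix b c assume "b \<in> B' - B" "c \<in> B' - B" "t b = t c" "b \<noteq> c"
    then show False using off[of c b] t(2)[of b] by auto
  qed
  have ind: "vec.independent (t ` (B' - B))"
    unfolding vec.dependent_def
  proof safe
    fix b assume b: "b \<in> B'" "t b \<in> vec.span (t ` (B' - B) - {t b})"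
    have "vec.span (t ` (B' - B) - {t b}) \<subseteq> {y. dot y b = 0}"
      by (rule vec.span_minimal)
         (use b off in \<open>auto simp: vec.subspace_def dot_add_left dot_scale_left\<close>)
    then show False using b t(2) by auto
  qed
  have "t ` (B' - B) \<subseteq> vanishing_forms Y"
  proof safe
    fix b assume b: "b \<in> B'" "b \<notin> B"
    have "t b \<in> vanishing_forms B"
      using b off B' by (auto simp: vanishing_forms_def)
    then have "t b \<in> vanishing_forms (vec.span B)" by (simp add: vanishing_forms_span)
    then show "t b \<in> vanishing_forms Y" using B(3) by (auto simp: vanishing_forms_def)
  qed
  from vec.independent_card_le_dim[OF this ind]
  have "card (B' - B) \<le> vec.dim (vanishing_forms Y)"
    by (simp add: card_image[OF inj])
  then show ?thesis
    using card_Diff_subset[OF finite_subset[OF B'(1) fin] B'(1)] cardB' B(4) by simp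
qed

section \<open>Faces and covers in a fan\<close>

text \<open>A face is cut out by a form that vanishes on it, so it contains every point of the cone at which
  all forms vanishing on the face vanish. Hence the linear span of a face determines the face.\<close>

lemma face_eqI_vanishing_forms:
  assumes "is_face F C" "is_face F' C" "vanishing_forms F = vanishing_forms F'"
  shows "F = F'"
proof -
  have "E' \<subseteq> E" if E: "is_face E C" "is_face E' C" "vanishing_forms E = vanishing_forms E'" for E E'
  proof -
    obtain u where u: "E = {x \<in> C. dot u x = 0}" using E(1) unfolding is_face_def by blast
    then have "u \<in> vanishing_forms E'" using E(3) by (auto simp: vanishing_forms_def)
    moreover have "E' \<subseteq> C" using E(2) unfolding is_face_def by blast
    ultimately show ?thesis by (auto simp: u vanishing_forms_def)
  qed
  then show ?thesis using assms by (metis subset_antisym)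
qed

lemma dim_proper_face_less:
  assumes "is_face F C" "F \<noteq> C"
  shows "vec.dim F < vec.dim C"
proof (rule ccontr)
  assume "\<not> vec.dim F < vec.dim C"
  moreover have FC: "F \<subseteq> C" using assms unfolding is_face_def by blast
  ultimately have "vec.span F = vec.span C" by (intro vec.dim_eq_span) auto
  then have "vanishing_forms F = vanishing_forms C" by (metis vanishing_forms_span)
  moreover have "is_face C C" unfolding is_face_def by (rule exI[of _ 0]) simp
  ultimately show False using face_eqI_vanishing_forms assms by blast
qed

lemma fan_face_memberI: "is_fan \<Sigma> \<Longrightarrow> C \<in> \<Sigma> \<Longrightarrow> is_face F C \<Longrightarrow> F \<in> \<Sigma>"
  unfolding is_fan_def by blast

lemma fan_subset_is_face:
  assumes "is_fan \<Sigma>" "\<sigma> \<in> \<Sigma>" "\<xi> \<in> \<Sigma>" "\<sigma> \<subseteq> \<xi>"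
  shows "is_face \<sigma> \<xi>"
proof -
  have "is_face (\<sigma> \<inter> \<xi>) \<xi>" using assms unfolding is_fan_def by blast
  then show ?thesis using assms(4) by (simp add: Int_absorb2)
qed

text \<open>Take \<open>\<xi>\<close> of least dimension among the cones strictly above \<open>\<sigma>\<close>. If its dimension exceeded that
  of \<open>\<sigma>\<close> by two or more, tilting the form that cuts \<open>\<sigma>\<close> out of \<open>\<xi>\<close>, until it is about to become
  negative somewhere on \<open>\<xi>\<close>, would produce a face strictly between the two, which belongs to
  the fan and has smaller dimension than \<open>\<xi>\<close>.\<close>

lemma fan_cover_exists:
  fixes \<Sigma> :: "(rat ^ 'n::finite) set set"
  assumes fan: "is_fan \<Sigma>" and "\<sigma> \<in> \<Sigma>" "\<alpha> \<in> \<Sigma>" "\<sigma> \<subset> \<alpha>"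
  obtains \<xi> where "\<xi> \<in> \<Sigma>" "is_face \<sigma> \<xi>" "vec.dim \<xi> = Suc (vec.dim \<sigma>)"
proof -
  obtain \<xi> where \<xi>: "\<xi> \<in> \<Sigma>" "\<sigma> \<subset> \<xi>"
    and least: "\<And>\<zeta>. \<zeta> \<in> \<Sigma> \<Longrightarrow> \<sigma> \<subset> \<zeta> \<Longrightarrow> vec.dim \<xi> \<le> vec.dim \<zeta>"
    using ex_has_least_nat[of "\<lambda>\<xi>. \<xi> \<in> \<Sigma> \<and> \<sigma> \<subset> \<xi>" \<alpha> "vec.dim"] assms by auto
  have face: "is_face \<sigma> \<xi>" using fan_subset_is_face[OF fan] assms(2) \<xi> by blast
  then obtain u where u: "\<And>x. x \<in> \<xi> \<Longrightarrow> 0 \<le> dot u x" "\<sigma> = {x \<in> \<xi>. dot u x = 0}"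
    unfolding is_face_def by blast
  obtain G where G: "finite G" "\<xi> = {(\<Sum>g\<in>G. c g *s g) | c. \<forall>g\<in>G. 0 \<le> c g}"
    using fan \<xi>(1) unfolding is_fan_def polyhedral_cone_def by meson
  have G\<xi>: "g \<in> \<xi>" if "g \<in> G" for g
  proof -
    have "(\<Sum>h\<in>G. (if h = g then 1 else 0) *s h) = (\<Sum>h\<in>G. if h = g then g else 0)"
      by (intro sum.cong) auto
    also have "\<dots> = g" using G(1) that by simp
    finally have "g = (\<Sum>h\<in>G. (if h = g then 1 else 0) *s h)" ..
    moreover have "\<forall>h\<in>G. 0 \<le> (if h = g then 1 else 0 :: rat)" by simp
    ultimately show ?thesis
      unfolding G(2) by (intro CollectI exI[of _ "\<lambda>h. if h = g then 1 else 0"] conjI)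
  qed
  have dot\<xi>: "\<exists>c. (\<forall>g\<in>G. 0 \<le> c g) \<and> (\<forall>w. dot w x = (\<Sum>g\<in>G. c g * dot w g))" if "x \<in> \<xi>" for x
  proof -
    obtain c where "x = (\<Sum>g\<in>G. c g *s g)" "\<forall>g\<in>G. 0 \<le> c g" using \<open>x \<in> \<xi>\<close> unfolding G(2) by blast
    then show ?thesis by (auto simp: dot_sum_right dot_scale_right)
  qed
  have "vec.dim \<sigma> < vec.dim \<xi>" using dim_proper_face_less[OF face] \<xi>(2) by blast
  moreover have "\<not> Suc (vec.dim \<sigma>) < vec.dim \<xi>"
  proof
    assume big: "Suc (vec.dim \<sigma>) < vec.dim \<xi>"
    \<comment> \<open>The generators outside \<open>\<sigma>\<close>.\<close>
    define G' where "G' = {g \<in> G. dot u g > 0}"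
    have G'0: "dot u g = 0" if "g \<in> G" "g \<notin> G'" for g
      using u(1)[OF G\<xi>[OF that(1)]] that by (auto simp: G'_def)
    have "G' \<noteq> {}"
    proof
      assume "G' = {}"
      then have "dot u g = 0" if "g \<in> G" for g using G'0 that by blast
      then have "dot u x = 0" if "x \<in> \<xi>" for x using dot\<xi>[OF that] by auto
      then show False using \<xi>(2) u(2) by blast
    qed
    then obtain g0 where g0: "g0 \<in> G'" by blast
    have "vec.dim (insert g0 \<sigma>) < vec.dim \<xi>"
      using big vec.dim_insert[of g0 \<sigma>] by (auto split: if_splits)
    then have "\<not> \<xi> \<subseteq> vec.span (insert g0 \<sigma>)"
      using vec.dim_subset[of \<xi> "vec.span (insert g0 \<sigma>)"] by (auto simp: vec.dim_span)
    \<comment> \<open>A form that vanishes on \<open>\<sigma>\<close> and at \<open>g0\<close> but not at \<open>y\<close> is no multiple of \<open>u\<close> on \<open>\<xi>\<close>, as \<open>u\<close> is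
      positive at \<open>g0\<close>; so no combination \<open>t - l u\<close> vanishes on all of \<open>\<xi>\<close>.\<close>
    then obtain y where y: "y \<in> \<xi>" "y \<notin> vec.span (insert g0 \<sigma>)" by blast
    obtain t where t: "t \<in> vanishing_forms (insert g0 \<sigma>)" "dot t y \<noteq> 0"
      using separating_form[OF y(2)] by blast
    have finG': "finite G'" using G(1) by (simp add: G'_def)
    \<comment> \<open>The slope at which the tilted form reaches zero on the generator \<open>g\<close>;
      the least slope keeps it nonnegative on all generators.\<close>
    define r where "r g = dot t g / dot u g" for g
    define l where "l = Min (r ` G')"
    have "l \<in> r ` G'" unfolding l_def using finG' \<open>G' \<noteq> {}\<close> by (intro Min_in) auto
    then obtain g1 where g1: "g1 \<in> G'" "l = r g1" by blast
    have l_le: "l \<le> r g" if "g \<in> G'" for g unfolding l_def using finG' that by (intro Min_le) auto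
    define w where "w = t - l *s u"
    have w: "dot w x = dot t x - l * dot u x" for x
      by (simp add: w_def dot_diff_left dot_scale_left)
    have t\<sigma>: "dot t x = 0" if "x \<in> \<sigma>" for x using t(1) that by (auto simp: vanishing_forms_def)
    have wG: "0 \<le> dot w g" if "g \<in> G" for g
    proof (cases "g \<in> G'")
      case True
      then have "dot u g > 0" by (simp add: G'_def)
      then show ?thesis using l_le[OF True] by (simp add: w r_def field_simps)
    next
      case False
      then have "dot u g = 0" using G'0 that by blast
      moreover have "g \<in> \<sigma>" using G\<xi>[OF that] calculation u(2) by blast
      ultimately show ?thesis using t\<sigma> by (simp add: w)
    qed
    have w\<xi>: "0 \<le> dot w x" if x: "x \<in> \<xi>" for x
    proof -
      obtain c where "\<forall>g\<in>G. 0 \<le> c g" "dot w x = (\<Sum>g\<in>G. c g * dot w g)" using dot\<xi>[OF x] by blast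
      then show ?thesis using wG by (auto intro!: sum_nonneg)
    qed
    define F where "F = {x \<in> \<xi>. dot w x = 0}"
    have F: "is_face F \<xi>" unfolding is_face_def F_def using w\<xi> by blast
    have "\<sigma> \<subseteq> F" using u(2) t\<sigma> by (auto simp: F_def w)
    moreover have "g1 \<in> F"
      using g1 G\<xi> by (auto simp: F_def w r_def G'_def)
    moreover have "g1 \<notin> \<sigma>" using g1(1) u(2) by (auto simp: G'_def)
    ultimately have "\<sigma> \<subset> F" by blast
    then have le: "vec.dim \<xi> \<le> vec.dim F" using least fan_face_memberI[OF fan \<xi>(1) F] by blast
    have "F \<noteq> \<xi>"
    proof
      assume "F = \<xi>"
      moreover have "g0 \<in> \<xi>" using g0 G\<xi> by (simp add: G'_def)
      ultimately have "dot w g0 = 0" "dot w y = 0" using y(1) by (auto simp: F_def)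
      moreover have "dot t g0 = 0" using t(1) by (simp add: vanishing_forms_def)
      moreover have "dot u g0 > 0" using g0 by (simp add: G'_def)
      ultimately show False using t(2) by (auto simp: w)
    qed
    then show False using dim_proper_face_less[OF F] le by simp
  qed
  ultimately have "vec.dim \<xi> = Suc (vec.dim \<sigma>)" by simp
  then show ?thesis using that \<xi>(1) face by blast
qed

section \<open>Incidence numbers\<close>

text \<open>The matrix expresses an independent family in a basis, so a linear relation between its rows
  would be one between the members of the family.\<close>

lemma orientation_sign_nonzero:
  fixes bs cs :: "(rat ^ 'n::finite) list"
  assumes bs: "distinct bs" "vec.independent (set bs)"
    and cs: "distinct cs" "vec.independent (set cs)"
    and span: "set cs \<subseteq> vec.span (set bs)" and len: "length cs = length bs"
  shows "orientation_sign bs cs \<noteq> 0"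
proof
  define n where "n = length bs"
  define A where "A = Matrix.mat n n (\<lambda>(i, j). vec.representation (set bs) (cs ! i) (bs ! j))"
  have A: "A \<in> carrier_mat n n" by (simp add: A_def)
  assume "orientation_sign bs cs = 0"
  then have "Determinant.det A = 0"
    by (simp add: orientation_sign_def A_def n_def sgn_0_0)
  then have "Determinant.det (transpose_mat A) = 0"
    using Determinant.det_transpose[OF A] by simp
  then obtain v where v: "v \<in> carrier_vec n" "v \<noteq> 0\<^sub>v n" "transpose_mat A *\<^sub>v v = 0\<^sub>v n"
    using det_0_iff_vec_prod_zero_field[of "transpose_mat A" n] A by auto
  have eq0: "(\<Sum>i<n. vec_index v i * vec.representation (set bs) (cs ! i) (bs ! j)) = 0" if j: "j < n" for j
  proof -
    have "vec_index (transpose_mat A *\<^sub>v v) j = 0" using v(3) j by simp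
    moreover have "vec_index (transpose_mat A *\<^sub>v v) j =
      (\<Sum>i<n. vec_index v i * vec.representation (set bs) (cs ! i) (bs ! j))"
      using j v(1) A by (auto simp: A_def scalar_prod_def atLeast0LessThan mult.commute intro!: sum.cong)
    ultimately show ?thesis by simp
  qed
  define x where "x = (\<Sum>i<n. vec_index v i *s (cs ! i))"
  have csi: "cs ! i \<in> vec.span (set bs)" if "i < n" for i
    using span len that n_def by auto
  have x: "x \<in> vec.span (set bs)"
    unfolding x_def by (intro vec.span_sum vec.span_scale) (use csi in auto)
  have "vec.representation (set bs) x (bs ! j) = 0" if "j < n" for j
  proof -
    have "vec.representation (set bs) x =
        (\<lambda>b. \<Sum>i<n. vec.representation (set bs) (vec_index v i *s (cs ! i)) b)"
      unfolding x_def by (rule vec.representation_sum) (use bs csi in \<open>auto intro: vec.span_scale\<close>)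
    then have "vec.representation (set bs) x (bs ! j) =
        (\<Sum>i<n. vec.representation (set bs) (vec_index v i *s (cs ! i)) (bs ! j))"
      by (rule fun_cong)
    also have "\<dots> = (\<Sum>i<n. vec_index v i * vec.representation (set bs) (cs ! i) (bs ! j))"
      by (intro sum.cong) (use bs csi in \<open>auto simp: vec.representation_scale\<close>)
    finally show ?thesis using eq0[OF that] by simp
  qed
  then have "vec.representation (set bs) x b = 0" if "b \<in> set bs" for b
    using that by (auto simp: in_set_conv_nth n_def)
  then have "x = 0"
    using vec.sum_representation_eq[OF bs(2) x finite_set order_refl] by simp
  \<comment> \<open>The coefficients of the relation, indexed by the members of \<open>cs\<close> instead of their positions.\<close>
  define f where "f c = vec_index v (the_inv_into {..<n} (nth cs) c)" for c
  have bij: "bij_betw (nth cs) {..<n} (set cs)"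
    using bij_betw_nth[OF cs(1)] len n_def by simp
  have f: "f (cs ! i) = vec_index v i" if "i < n" for i
    using the_inv_into_f_f[of "nth cs" "{..<n}" i] bij that by (simp add: f_def bij_betw_def)
  have "(\<Sum>c\<in>set cs. f c *s c) = (\<Sum>i<n. f (cs ! i) *s (cs ! i))"
    by (rule sum.reindex_bij_betw[OF bij, symmetric])
  also have "\<dots> = 0" using \<open>x = 0\<close> f by (simp add: x_def)
  finally have sum0: "(\<Sum>c\<in>set cs. f c *s c) = 0" .
  have "vec_index v i = 0" if "i < n" for i
  proof -
    have mem: "cs ! i \<in> set cs" using that len n_def by simp
    have "f (cs ! i) = 0"
      by (rule vec.independentD[OF cs(2) finite_set order_refl sum0 mem])
    then show ?thesis using f[OF that] by simp
  qed
  then have "\<And>i. i < dim_vec (0\<^sub>v n) \<Longrightarrow> vec_index v i = vec_index (0\<^sub>v n) i" by simp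
  moreover have "dim_vec v = dim_vec (0\<^sub>v n :: rat Matrix.vec)" using v(1) by simp
  ultimately have "v = 0\<^sub>v n" by (rule eq_vecI)
  then show False using v(2) by simp
qed

text \<open>An inward vector together with a basis of the span of the facet is a basis of the span of the
  cone.\<close>

lemma incidence_nonzero:
  assumes ori: "is_orientation ori \<Sigma>" and "\<alpha> \<in> \<Sigma>" "\<beta> \<in> \<Sigma>" "\<beta> \<subseteq> \<alpha>"
    and dim: "vec.dim \<alpha> = Suc (vec.dim \<beta>)"
  shows "incidence ori \<alpha> \<beta> \<noteq> 0"
proof -
  have o: "distinct (ori \<xi>)" "vec.independent (set (ori \<xi>))" "vec.span (set (ori \<xi>)) = vec.span \<xi>"
    "length (ori \<xi>) = vec.dim \<xi>" if "\<xi> \<in> \<Sigma>" for \<xi>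
  proof -
    show o: "distinct (ori \<xi>)" "vec.independent (set (ori \<xi>))" "vec.span (set (ori \<xi>)) = vec.span \<xi>"
      using ori that unfolding is_orientation_def by blast+
    have "vec.dim \<xi> = vec.dim (set (ori \<xi>))" by (metis o(3) vec.dim_span)
    then show "length (ori \<xi>) = vec.dim \<xi>"
      using o(1,2) by (simp add: vec.dim_eq_card_independent distinct_card)
  qed
  define v where "v = (SOME v. v \<in> \<alpha> - vec.span \<beta>)"
  have "\<not> \<alpha> \<subseteq> vec.span \<beta>"
    using vec.dim_subset[of \<alpha> "vec.span \<beta>"] dim by (auto simp: vec.dim_span)
  then have "\<exists>v. v \<in> \<alpha> - vec.span \<beta>" by blast
  from someI_ex[OF this] have v: "v \<in> \<alpha> - vec.span \<beta>" unfolding v_def .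
  have nv: "- v \<notin> vec.span (set (ori \<beta>))"
    using v o(3)[OF assms(3)] vec.span_neg[of "- v"] by auto
  have "orientation_sign (ori \<alpha>) (- v # ori \<beta>) \<noteq> 0"
  proof (rule orientation_sign_nonzero)
    show "distinct (- v # ori \<beta>)"
      using o(1)[OF assms(3)] nv vec.span_base by auto
    show "vec.independent (set (- v # ori \<beta>))"
      using o(2)[OF assms(3)] nv by (simp add: vec.independent_insertI)
    have "- v \<in> vec.span \<alpha>" using v vec.span_base vec.span_neg by blast
    moreover have "set (ori \<beta>) \<subseteq> vec.span \<alpha>"
      using o(3)[OF assms(3)] vec.span_mono[OF assms(4)] vec.span_superset by blast
    ultimately show "set (- v # ori \<beta>) \<subseteq> vec.span (set (ori \<alpha>))"
      using o(3)[OF assms(2)] by simp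
  qed (use o assms dim in auto)
  then show ?thesis by (simp add: incidence_def v_def)
qed

section \<open>Chains and boundaries by polynomial representatives\<close>

lemma cone_ideal_eq: "cone_ideal \<xi> = Idl\<^bsub>polynomial_ring\<^esub> (linear_form ` vanishing_forms \<xi>)"
  using vanishing_forms_span[of \<xi>] by (simp add: cone_ideal_def vanishing_forms_def)

lemma ideal_cone_ideal: "ideal (cone_ideal \<xi>) polynomial_ring"
  unfolding cone_ideal_def by (rule poly_ring.genideal_ideal) simp

lemmas cone_idealD = polynomial_idealD[OF ideal_cone_ideal]

lemma linear_form_in_cone_ideal: "a \<in> vanishing_forms \<xi> \<Longrightarrow> linear_form a \<in> cone_ideal \<xi>"
  unfolding cone_ideal_eq using poly_ring.genideal_self[of "linear_form ` vanishing_forms \<xi>"] by auto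

lemma cone_ideal_antimono:
  assumes "\<beta> \<subseteq> \<alpha>" shows "cone_ideal \<alpha> \<subseteq> cone_ideal \<beta>"
proof -
  have "linear_form ` vanishing_forms \<alpha> \<subseteq> cone_ideal \<beta>"
  proof safe
    fix a assume "a \<in> vanishing_forms \<alpha>"
    then have "a \<in> vanishing_forms \<beta>" using assms unfolding vanishing_forms_def by blast
    then show "linear_form a \<in> cone_ideal \<beta>" by (rule linear_form_in_cone_ideal)
  qed
  then show ?thesis
    unfolding cone_ideal_eq[of \<alpha>] by (rule poly_ring.genideal_minimal[OF ideal_cone_ideal])
qed

text \<open>The class of a polynomial in \<open>S/I\<^sub>\<beta>\<close>. All modules and maps of the complex are rewritten below in
  terms of polynomial representatives.\<close>

definition residue :: "(rat ^ 'n::finite) set \<Rightarrow> 'n poly_alg \<Rightarrow> ('n poly_alg) set" where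
  "residue \<beta> p = {q. q - p \<in> cone_ideal \<beta>}"

lemma residue_eq_iff: "residue \<beta> p = residue \<beta> q \<longleftrightarrow> p - q \<in> cone_ideal \<beta>"
proof
  assume "residue \<beta> p = residue \<beta> q"
  moreover have "p \<in> residue \<beta> p" by (simp add: residue_def cone_idealD(1))
  ultimately show "p - q \<in> cone_ideal \<beta>" by (simp add: residue_def)
next
  assume pq: "p - q \<in> cone_ideal \<beta>"
  have "r - p \<in> cone_ideal \<beta> \<longleftrightarrow> r - q \<in> cone_ideal \<beta>" for r
    using cone_idealD(2)[OF _ pq, of "r - p"] cone_idealD(5)[OF _ pq, of "r - q"]
    by (auto simp: algebra_simps)
  then show "residue \<beta> p = residue \<beta> q" by (simp add: residue_def)
qed

lemma residue_self: "p \<in> residue \<beta> p"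
  by (simp add: residue_def cone_idealD(1))

lemma residue_0: "residue \<beta> 0 = cone_ideal \<beta>"
  by (simp add: residue_def)

lemma coset_cone_ideal:
  "a_r_coset (regular_module polynomial_ring) (cone_ideal \<beta>) p = residue \<beta> p"
proof -
  have "q \<in> residue \<beta> p \<Longrightarrow> \<exists>h\<in>cone_ideal \<beta>. q = h + p" for q
    by (rule bexI[of _ "q - p"]) (auto simp: residue_def)
  then show ?thesis
    by (auto simp: a_r_coset_def' regular_module_def residue_def)
qed

lemma cone_module_carrier: "carrier (cone_module \<beta>) = range (residue \<beta>)"
  by (auto simp: cone_module_def quotient_module_def A_RCOSETS_def' coset_cone_ideal)
     (auto simp: regular_module_def)

lemma cone_module_zero: "\<zero>\<^bsub>cone_module \<beta>\<^esub> = residue \<beta> 0"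
  by (simp add: cone_module_def quotient_module_def residue_0)

lemma cone_module_add:
  "residue \<beta> p \<oplus>\<^bsub>cone_module \<beta>\<^esub> residue \<beta> q = residue \<beta> (p + q)"
proof -
  have "residue \<beta> p \<oplus>\<^bsub>cone_module \<beta>\<^esub> residue \<beta> q = (\<Union>x\<in>residue \<beta> p. \<Union>y\<in>residue \<beta> q. {x + y})"
    by (simp add: cone_module_def quotient_module_def set_add_def' regular_module_def)
  also have "\<dots> = residue \<beta> (p + q)"
  proof safe
    fix x y assume "x \<in> residue \<beta> p" "y \<in> residue \<beta> q"
    then have "(x - p) + (y - q) \<in> cone_ideal \<beta>" by (auto simp: residue_def intro: cone_idealD(2))
    then show "x + y \<in> residue \<beta> (p + q)" by (simp add: residue_def algebra_simps)
  next
    fix z assume "z \<in> residue \<beta> (p + q)"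
    then have "z - q \<in> residue \<beta> p" by (simp add: residue_def algebra_simps)
    moreover have "z = (z - q) + q" by simp
    ultimately show "z \<in> (\<Union>x\<in>residue \<beta> p. \<Union>y\<in>residue \<beta> q. {x + y})"
      using residue_self[of q \<beta>] by blast
  qed
  finally show ?thesis .
qed

lemma cone_module_smult: "r \<odot>\<^bsub>cone_module \<beta>\<^esub> residue \<beta> p = residue \<beta> (r * p)"
proof -
  have "residue \<beta> (r * x) = residue \<beta> (r * p)" if "x \<in> residue \<beta> p" for x
    using cone_idealD(3)[of "x - p" \<beta> r] that
    by (simp add: residue_eq_iff) (simp add: residue_def right_diff_distrib)
  moreover have "r \<odot>\<^bsub>cone_module \<beta>\<^esub> residue \<beta> p = (\<Union>x\<in>residue \<beta> p. residue \<beta> (r * x))"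
    by (simp add: cone_module_def quotient_module_def coset_cone_ideal)
       (simp add: regular_module_def)
  ultimately show ?thesis using residue_self[of p \<beta>] by blast
qed

text \<open>For a face \<open>\<beta>\<close> of \<open>\<alpha>\<close> this identifies the set-theoretic expression in the differential with
  the projection \<open>S/I\<^sub>\<alpha> \<rightarrow> S/I\<^sub>\<beta>\<close>.\<close>

lemma project_residue:
  assumes "\<beta> \<subseteq> \<alpha>"
  shows "cone_ideal \<beta> <+>\<^bsub>polynomial_ring\<^esub> residue \<alpha> p = residue \<beta> p"
proof -
  have "cone_ideal \<beta> <+>\<^bsub>polynomial_ring\<^esub> residue \<alpha> p = (\<Union>x\<in>cone_ideal \<beta>. \<Union>y\<in>residue \<alpha> p. {x + y})"
    by (simp add: set_add_def')
  also have "\<dots> = residue \<beta> p"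
  proof safe
    fix x y assume "x \<in> cone_ideal \<beta>" "y \<in> residue \<alpha> p"
    then have "x + (y - p) \<in> cone_ideal \<beta>"
      using cone_ideal_antimono[OF assms] by (auto simp: residue_def intro: cone_idealD(2))
    then show "x + y \<in> residue \<beta> p" by (simp add: residue_def algebra_simps)
  next
    fix z assume "z \<in> residue \<beta> p"
    then have "z - p \<in> cone_ideal \<beta>" by (simp add: residue_def)
    moreover have "z = (z - p) + p" by simp
    ultimately show "z \<in> (\<Union>x\<in>cone_ideal \<beta>. \<Union>y\<in>residue \<alpha> p. {x + y})"
      using residue_self[of p \<alpha>] by blast
  qed
  finally show ?thesis .
qed

lemma abelian_monoid_cone_module: "abelian_monoid (cone_module \<beta>)"
  by (rule abelian_monoidI)
     (auto simp: cone_module_carrier cone_module_zero cone_module_add add_ac)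

lemma finsum_cone_module:
  assumes "finite A"
  shows "(\<Oplus>\<^bsub>cone_module \<beta>\<^esub>\<alpha>\<in>A. residue \<beta> (g \<alpha>)) = residue \<beta> (\<Sum>\<alpha>\<in>A. g \<alpha>)"
proof -
  interpret abelian_monoid "cone_module \<beta>" by (rule abelian_monoid_cone_module)
  show ?thesis using assms
  proof (induction A)
    case empty
    show ?case by (simp add: cone_module_zero)
  next
    case (insert a A)
    then have "(\<Oplus>\<^bsub>cone_module \<beta>\<^esub>\<alpha>\<in>insert a A. residue \<beta> (g \<alpha>)) =
       residue \<beta> (g a) \<oplus>\<^bsub>cone_module \<beta>\<^esub> (\<Oplus>\<^bsub>cone_module \<beta>\<^esub>\<alpha>\<in>A. residue \<beta> (g \<alpha>))"
      by (intro finsum_insert) (auto simp: cone_module_carrier)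
    then show ?case using insert by (simp add: cone_module_add)
  qed
qed

definition chain_of ::
    "(rat ^ 'n::finite) set set \<Rightarrow> nat \<Rightarrow> ((rat ^ 'n) set \<Rightarrow> 'n poly_alg) \<Rightarrow>
     (rat ^ 'n) set \<Rightarrow> ('n poly_alg) set" where
  "chain_of \<Sigma> k p = (\<lambda>\<alpha>\<in>chain_cones \<Sigma> k. residue \<alpha> (p \<alpha>))"

lemma chain_of_eqI:
  assumes "\<And>\<alpha>. \<alpha> \<in> chain_cones \<Sigma> k \<Longrightarrow> p \<alpha> - q \<alpha> \<in> cone_ideal \<alpha>"
  shows "chain_of \<Sigma> k p = chain_of \<Sigma> k q"
  unfolding chain_of_def by (rule restrict_ext) (use assms in \<open>auto simp: residue_eq_iff\<close>)

lemma chain_module_carrier: "carrier (chain_module \<Sigma> k) = range (chain_of \<Sigma> k)"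
proof
  show "range (chain_of \<Sigma> k) \<subseteq> carrier (chain_module \<Sigma> k)"
    by (auto simp: chain_of_def chain_module_def direct_sum_module_def cone_module_carrier)
  show "carrier (chain_module \<Sigma> k) \<subseteq> range (chain_of \<Sigma> k)"
  proof
    fix f assume f: "f \<in> carrier (chain_module \<Sigma> k)"
    then have "\<exists>p. f \<alpha> = residue \<alpha> p" if "\<alpha> \<in> chain_cones \<Sigma> k" for \<alpha>
      using that by (fastforce simp: chain_module_def direct_sum_module_def cone_module_carrier)
    then obtain p where "\<And>\<alpha>. \<alpha> \<in> chain_cones \<Sigma> k \<Longrightarrow> f \<alpha> = residue \<alpha> (p \<alpha>)" by metis
    then have "f = chain_of \<Sigma> k p"
      using f by (intro ext)
        (auto simp: chain_of_def chain_module_def direct_sum_module_def restrict_def PiE_def extensional_def)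
    then show "f \<in> range (chain_of \<Sigma> k)" by blast
  qed
qed

lemma chain_module_ops:
  "\<zero>\<^bsub>chain_module \<Sigma> k\<^esub> = chain_of \<Sigma> k (\<lambda>_. 0)"
  "chain_of \<Sigma> k p \<oplus>\<^bsub>chain_module \<Sigma> k\<^esub> chain_of \<Sigma> k q = chain_of \<Sigma> k (\<lambda>\<alpha>. p \<alpha> + q \<alpha>)"
  "r \<odot>\<^bsub>chain_module \<Sigma> k\<^esub> chain_of \<Sigma> k p = chain_of \<Sigma> k (\<lambda>\<alpha>. r * p \<alpha>)"
  by (auto simp: chain_module_def direct_sum_module_def chain_of_def cone_module_zero
      cone_module_add cone_module_smult cong: restrict_cong)

lemma module_chain_module:
  fixes \<Sigma> :: "(rat ^ 'n::finite) set set"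
  shows "module polynomial_ring (chain_module \<Sigma> k)"
proof (rule moduleI)
  show "cring (polynomial_ring :: ('n poly_alg) ring)" by (rule poly_ring.is_cring)
  show "abelian_group (chain_module \<Sigma> k)"
  proof (rule abelian_groupI)
    fix x assume "x \<in> carrier (chain_module \<Sigma> k)"
    then obtain p where "x = chain_of \<Sigma> k p" by (auto simp: chain_module_carrier)
    then have "chain_of \<Sigma> k (\<lambda>\<alpha>. - p \<alpha>) \<oplus>\<^bsub>chain_module \<Sigma> k\<^esub> x = \<zero>\<^bsub>chain_module \<Sigma> k\<^esub>"
      by (simp add: chain_module_ops)
    then show "\<exists>y\<in>carrier (chain_module \<Sigma> k). y \<oplus>\<^bsub>chain_module \<Sigma> k\<^esub> x = \<zero>\<^bsub>chain_module \<Sigma> k\<^esub>"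
      by (auto simp: chain_module_carrier)
  qed (auto simp: chain_module_carrier chain_module_ops add_ac)
qed (auto simp: chain_module_carrier chain_module_ops algebra_simps)

lemma finite_chain_cones: "is_fan \<Sigma> \<Longrightarrow> finite (chain_cones \<Sigma> k)"
  by (auto simp: is_fan_def chain_cones_def interior_cones_def cones_def)

definition boundary_coeffs ::
    "((rat ^ 'n::finite) set \<Rightarrow> (rat ^ 'n) list) \<Rightarrow> (rat ^ 'n) set set \<Rightarrow> nat \<Rightarrow>
     ((rat ^ 'n) set \<Rightarrow> 'n poly_alg) \<Rightarrow> (rat ^ 'n) set \<Rightarrow> 'n poly_alg" where
  "boundary_coeffs ori \<Sigma> k p \<beta> = (\<Sum>\<alpha> | \<alpha> \<in> chain_cones \<Sigma> k \<and> is_face \<beta> \<alpha>.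
     Poly_Mapping.single 0 (incidence ori \<alpha> \<beta>) * p \<alpha>)"

text \<open>The differential lifts to polynomial representatives, where it is an ordinary finite sum. This
  turns the search for a preimage of a chain into a computation with polynomials.\<close>

lemma boundary_map_chain_of:
  fixes \<Sigma> :: "(rat ^ 'n::finite) set set"
  assumes "is_fan \<Sigma>"
  shows "boundary_map ori \<Sigma> k (chain_of \<Sigma> k p) = chain_of \<Sigma> (k - 1) (boundary_coeffs ori \<Sigma> k p)"
  unfolding boundary_map_def chain_of_def[of \<Sigma> "k - 1"]
proof (rule restrict_ext)
  fix \<beta> :: "(rat ^ 'n) set"
  interpret abelian_monoid "cone_module \<beta>" by (rule abelian_monoid_cone_module)
  let ?A = "{\<alpha> \<in> chain_cones \<Sigma> k. is_face \<beta> \<alpha>}"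
  have "(\<Oplus>\<^bsub>cone_module \<beta>\<^esub>\<alpha>\<in>?A. Poly_Mapping.single 0 (incidence ori \<alpha> \<beta>)
          \<odot>\<^bsub>cone_module \<beta>\<^esub> (cone_ideal \<beta> <+>\<^bsub>polynomial_ring\<^esub> chain_of \<Sigma> k p \<alpha>)) =
     (\<Oplus>\<^bsub>cone_module \<beta>\<^esub>\<alpha>\<in>?A. residue \<beta> (Poly_Mapping.single 0 (incidence ori \<alpha> \<beta>) * p \<alpha>))"
  proof (rule finsum_cong')
    fix \<alpha> assume \<alpha>: "\<alpha> \<in> ?A"
    then have "\<beta> \<subseteq> \<alpha>" by (auto simp: is_face_def)
    then show "Poly_Mapping.single 0 (incidence ori \<alpha> \<beta>)
          \<odot>\<^bsub>cone_module \<beta>\<^esub> (cone_ideal \<beta> <+>\<^bsub>polynomial_ring\<^esub> chain_of \<Sigma> k p \<alpha>) =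
        residue \<beta> (Poly_Mapping.single 0 (incidence ori \<alpha> \<beta>) * p \<alpha>)"
      using \<alpha> by (simp add: chain_of_def project_residue cone_module_smult)
  qed (auto simp: cone_module_carrier)
  also have "\<dots> = residue \<beta> (boundary_coeffs ori \<Sigma> k p \<beta>)"
    unfolding boundary_coeffs_def
    by (rule finsum_cone_module) (use finite_chain_cones[OF assms, of k] in auto)
  finally show "(\<Oplus>\<^bsub>cone_module \<beta>\<^esub>\<alpha>\<in>?A. Poly_Mapping.single 0 (incidence ori \<alpha> \<beta>)
          \<odot>\<^bsub>cone_module \<beta>\<^esub> (cone_ideal \<beta> <+>\<^bsub>polynomial_ring\<^esub> chain_of \<Sigma> k p \<alpha>)) =
     residue \<beta> (boundary_coeffs ori \<Sigma> k p \<beta>)" .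
qed

section \<open>Quotients that vanish locally\<close>

lemma submodule_zero_closed:
  assumes "submodule N R M" shows "\<zero>\<^bsub>M\<^esub> \<in> N"
  using subgroup.one_closed[OF submodule.axioms(1)[OF assms]] by simp

lemma submodule_coset_absorb:
  assumes "module R M" and sub: "submodule N R M" and n: "n \<in> N" and y: "y \<in> carrier M"
  shows "N +>\<^bsub>M\<^esub> (n \<oplus>\<^bsub>M\<^esub> y) = N +>\<^bsub>M\<^esub> y"
proof -
  interpret module R M by fact
  note N = submoduleE(1)[OF sub]
  show ?thesis
  proof (intro equalityI subsetI)
    fix z assume "z \<in> N +>\<^bsub>M\<^esub> (n \<oplus>\<^bsub>M\<^esub> y)"
    then obtain h where h: "h \<in> N" "z = h \<oplus>\<^bsub>M\<^esub> (n \<oplus>\<^bsub>M\<^esub> y)" unfolding a_r_coset_def' by blast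
    have "z = (h \<oplus>\<^bsub>M\<^esub> n) \<oplus>\<^bsub>M\<^esub> y" using h n y N by (simp add: M.a_assoc subsetD)
    moreover have "h \<oplus>\<^bsub>M\<^esub> n \<in> N" by (rule submoduleE(5)[OF sub h(1) n])
    ultimately show "z \<in> N +>\<^bsub>M\<^esub> y" unfolding a_r_coset_def' by blast
  next
    fix z assume "z \<in> N +>\<^bsub>M\<^esub> y"
    then obtain h where h: "h \<in> N" "z = h \<oplus>\<^bsub>M\<^esub> y" unfolding a_r_coset_def' by blast
    have c: "h \<in> carrier M" "n \<in> carrier M" using h(1) n N by auto
    then have "(h \<oplus>\<^bsub>M\<^esub> \<ominus>\<^bsub>M\<^esub> n) \<oplus>\<^bsub>M\<^esub> (n \<oplus>\<^bsub>M\<^esub> y) = h \<oplus>\<^bsub>M\<^esub> (\<ominus>\<^bsub>M\<^esub> n \<oplus>\<^bsub>M\<^esub> (n \<oplus>\<^bsub>M\<^esub> y))"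
      using y by (simp add: M.a_assoc)
    also have "\<ominus>\<^bsub>M\<^esub> n \<oplus>\<^bsub>M\<^esub> (n \<oplus>\<^bsub>M\<^esub> y) = y" using c y by (simp add: M.r_neg1)
    finally have "z = (h \<oplus>\<^bsub>M\<^esub> \<ominus>\<^bsub>M\<^esub> n) \<oplus>\<^bsub>M\<^esub> (n \<oplus>\<^bsub>M\<^esub> y)" using h(2) by simp
    moreover have "h \<oplus>\<^bsub>M\<^esub> \<ominus>\<^bsub>M\<^esub> n \<in> N"
      by (rule submoduleE(5)[OF sub h(1) submoduleE(3)[OF sub n]])
    ultimately show "z \<in> N +>\<^bsub>M\<^esub> (n \<oplus>\<^bsub>M\<^esub> y)" unfolding a_r_coset_def' by blast
  qed
qed

lemma submodule_coset_of_member: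
  assumes "module R M" and sub: "submodule N R M" and x: "x \<in> N"
  shows "N +>\<^bsub>M\<^esub> x = N"
proof -
  interpret module R M by fact
  note N = submoduleE(1)[OF sub]
  have "N +>\<^bsub>M\<^esub> x = N +>\<^bsub>M\<^esub> \<zero>\<^bsub>M\<^esub>"
    using submodule_coset_absorb[OF assms M.zero_closed] x N by (simp add: subsetD)
  also have "\<dots> = N"
  proof -
    have "h \<oplus>\<^bsub>M\<^esub> \<zero>\<^bsub>M\<^esub> = h" if "h \<in> N" for h using that N by (simp add: subsetD)
    then show ?thesis unfolding a_r_coset_def' by auto
  qed
  finally show ?thesis .
qed

text \<open>The cosets of \<open>N\<close> are formed in \<open>M\<close>, as shrinking the carrier of \<open>M\<close> leaves them unchanged. With
  the cycles as \<open>K\<close> and the boundaries as \<open>N\<close> this computes in homology.\<close>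

lemma quotient_module_smult_coset:
  assumes "module R M" and sub: "submodule N R M"
    and x: "x \<in> carrier M" and r: "r \<in> carrier R"
  shows "r \<odot>\<^bsub>quotient_module (M\<lparr>carrier := K\<rparr>) N\<^esub> (N +>\<^bsub>M\<^esub> x) = N +>\<^bsub>M\<^esub> (r \<odot>\<^bsub>M\<^esub> x)"
proof -
  interpret module R M by fact
  note N = submoduleE(1)[OF sub]
  have "N +>\<^bsub>M\<^esub> (r \<odot>\<^bsub>M\<^esub> y) = N +>\<^bsub>M\<^esub> (r \<odot>\<^bsub>M\<^esub> x)" if y: "y \<in> N +>\<^bsub>M\<^esub> x" for y
  proof -
    obtain n where n: "n \<in> N" "y = n \<oplus>\<^bsub>M\<^esub> x" using y unfolding a_r_coset_def' by blast
    then have "r \<odot>\<^bsub>M\<^esub> y = (r \<odot>\<^bsub>M\<^esub> n) \<oplus>\<^bsub>M\<^esub> (r \<odot>\<^bsub>M\<^esub> x)"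
      using x r N by (simp add: smult_r_distr subsetD)
    then show ?thesis
      using submodule_coset_absorb[OF assms(1,2) submoduleE(4)[OF sub r n(1)] smult_closed[OF r x]]
      by simp
  qed
  moreover have "x \<in> N +>\<^bsub>M\<^esub> x"
  proof -
    have "x = \<zero>\<^bsub>M\<^esub> \<oplus>\<^bsub>M\<^esub> x" using x by simp
    then show ?thesis using submodule_zero_closed[OF sub] unfolding a_r_coset_def' by blast
  qed
  ultimately have "(\<Union>y\<in>N +>\<^bsub>M\<^esub> x. N +>\<^bsub>M\<^esub> (r \<odot>\<^bsub>M\<^esub> y)) = N +>\<^bsub>M\<^esub> (r \<odot>\<^bsub>M\<^esub> x)" by blast
  then show ?thesis by (simp add: quotient_module_def a_r_coset_def')
qed

text \<open>If every element of \<open>K\<close> is moved into \<open>N\<close> by a scalar outside \<open>P\<close>, then each class of the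
  quotient is killed by such a scalar. So all fractions with denominators outside \<open>P\<close> are
  equal, and no annihilator of an element can be \<open>P\<close>.\<close>

lemma locally_zero_quotient:
  fixes R :: "('r, 'k) ring_scheme" and M :: "('r, 'a) module"
  assumes M: "module R M" and sub: "submodule N R M"
    and K: "K \<subseteq> carrier M" "\<zero>\<^bsub>M\<^esub> \<in> K"
    and P: "primeideal P R"
    and kill: "\<And>x. x \<in> K \<Longrightarrow> \<exists>s\<in>carrier R - P. s \<odot>\<^bsub>M\<^esub> x \<in> N"
  shows "P \<notin> module_support R (quotient_module (M\<lparr>carrier := K\<rparr>) N)"
    and "P \<notin> associated_primes R (quotient_module (M\<lparr>carrier := K\<rparr>) N)"
proof -
  interpret module R M by fact
  interpret P: primeideal P R by fact
  let ?Q = "quotient_module (M\<lparr>carrier := K\<rparr>) N"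
  note N = submoduleE(1)[OF sub] and smult = submoduleE(4)[OF sub]
  note coset = quotient_module_smult_coset[OF M sub] and member = submodule_coset_of_member[OF M sub]
  have carrier: "carrier ?Q = (\<lambda>x. N +>\<^bsub>M\<^esub> x) ` K"
    by (auto simp: quotient_module_def A_RCOSETS_def' a_r_coset_def')
  have zero: "\<zero>\<^bsub>?Q\<^esub> = N" by (simp add: quotient_module_def)
  have zero_in: "N \<in> carrier ?Q"
    using member[OF submodule_zero_closed[OF sub]] K(2) unfolding carrier by (metis imageI)
  have one: "\<one>\<^bsub>R\<^esub> \<in> carrier R - P"
    using P.I_notcarr P.one_imp_carrier by auto
  have mult: "s \<otimes>\<^bsub>R\<^esub> t \<in> carrier R - P" if "s \<in> carrier R - P" "t \<in> carrier R - P" for s t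
    using that P.I_prime by auto
  have kill': "(a \<otimes>\<^bsub>R\<^esub> s) \<odot>\<^bsub>?Q\<^esub> (t \<odot>\<^bsub>?Q\<^esub> (N +>\<^bsub>M\<^esub> x)) = N"
    if "x \<in> carrier M" "s \<in> carrier R" "s \<odot>\<^bsub>M\<^esub> x \<in> N" "a \<in> carrier R" "t \<in> carrier R" for a s t x
  proof -
    have "(a \<otimes>\<^bsub>R\<^esub> s) \<odot>\<^bsub>M\<^esub> (t \<odot>\<^bsub>M\<^esub> x) = (a \<otimes>\<^bsub>R\<^esub> s \<otimes>\<^bsub>R\<^esub> t) \<odot>\<^bsub>M\<^esub> x"
      using that by (simp add: smult_assoc1)
    also have "a \<otimes>\<^bsub>R\<^esub> s \<otimes>\<^bsub>R\<^esub> t = (a \<otimes>\<^bsub>R\<^esub> t) \<otimes>\<^bsub>R\<^esub> s"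
      using that by (simp add: R.m_ac)
    also have "((a \<otimes>\<^bsub>R\<^esub> t) \<otimes>\<^bsub>R\<^esub> s) \<odot>\<^bsub>M\<^esub> x = (a \<otimes>\<^bsub>R\<^esub> t) \<odot>\<^bsub>M\<^esub> (s \<odot>\<^bsub>M\<^esub> x)"
      using that by (intro smult_assoc1) auto
    also have "\<dots> \<in> N" by (rule smult) (use that in auto)
    finally have "(a \<otimes>\<^bsub>R\<^esub> s) \<odot>\<^bsub>M\<^esub> (t \<odot>\<^bsub>M\<^esub> x) \<in> N" .
    then have "N +>\<^bsub>M\<^esub> ((a \<otimes>\<^bsub>R\<^esub> s) \<odot>\<^bsub>M\<^esub> (t \<odot>\<^bsub>M\<^esub> x)) = N"
      by (rule member)
    then show ?thesis using that by (simp add: coset)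
  qed
  show "P \<notin> associated_primes R ?Q"
  proof
    assume "P \<in> associated_primes R ?Q"
    then obtain m where m: "m \<in> carrier ?Q" "P = {r \<in> carrier R. r \<odot>\<^bsub>?Q\<^esub> m = N}"
      unfolding associated_primes_def zero by blast
    obtain x where x: "x \<in> K" "m = N +>\<^bsub>M\<^esub> x" using m(1) unfolding carrier by blast
    obtain s where s: "s \<in> carrier R - P" "s \<odot>\<^bsub>M\<^esub> x \<in> N" using kill[OF x(1)] by blast
    have "s \<odot>\<^bsub>?Q\<^esub> m = N +>\<^bsub>M\<^esub> (s \<odot>\<^bsub>M\<^esub> x)"
      unfolding x(2) by (rule coset) (use s x K in auto)
    also have "\<dots> = N" by (rule member[OF s(2)])
    finally have "s \<in> P" using s(1) by (subst m(2)) blast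
    then show False using s(1) by blast
  qed
  have rel: "((m, s), (n, t)) \<in> localization_rel R ?Q P"
    if m: "m \<in> carrier ?Q" and n: "n \<in> carrier ?Q" and s: "s \<in> carrier R - P" and t: "t \<in> carrier R - P"
    for m n s t
  proof -
    obtain x where x: "x \<in> K" "m = N +>\<^bsub>M\<^esub> x" using m unfolding carrier by blast
    obtain y where y: "y \<in> K" "n = N +>\<^bsub>M\<^esub> y" using n unfolding carrier by blast
    obtain a where a: "a \<in> carrier R - P" "a \<odot>\<^bsub>M\<^esub> x \<in> N" using kill[OF x(1)] by blast
    obtain b where b: "b \<in> carrier R - P" "b \<odot>\<^bsub>M\<^esub> y \<in> N" using kill[OF y(1)] by blast
    have "(b \<otimes>\<^bsub>R\<^esub> a) \<odot>\<^bsub>?Q\<^esub> (t \<odot>\<^bsub>?Q\<^esub> m) = N"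
      unfolding x(2) by (rule kill') (use x a b t K in auto)
    moreover have "(a \<otimes>\<^bsub>R\<^esub> b) \<odot>\<^bsub>?Q\<^esub> (s \<odot>\<^bsub>?Q\<^esub> n) = N"
      unfolding y(2) by (rule kill') (use y a b s K in auto)
    moreover have "a \<otimes>\<^bsub>R\<^esub> b = b \<otimes>\<^bsub>R\<^esub> a" using a b by (simp add: R.m_comm)
    moreover have "b \<otimes>\<^bsub>R\<^esub> a \<in> carrier R - P" using mult a(1) b(1) by blast
    ultimately have "\<exists>u\<in>carrier R - P. u \<odot>\<^bsub>?Q\<^esub> (t \<odot>\<^bsub>?Q\<^esub> m) = u \<odot>\<^bsub>?Q\<^esub> (s \<odot>\<^bsub>?Q\<^esub> n)" by metis
    then show ?thesis using m n s t unfolding localization_rel_def by blast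
  qed
  let ?T = "carrier ?Q \<times> (carrier R - P)"
  have "localization_rel R ?Q P = ?T \<times> ?T"
    using rel by (auto simp: localization_rel_def)
  moreover have "(N, \<one>\<^bsub>R\<^esub>) \<in> ?T" using zero_in one by blast
  ultimately have "localized_module R ?Q P = {localized_zero R ?Q P}"
    unfolding localized_module_def localized_zero_def zero quotient_def by auto
  then show "P \<notin> module_support R ?Q" unfolding module_support_def by blast
qed

section \<open>Homology at a prime with few linear forms\<close>

lemma prod_notin_prime:
  assumes P: "primeideal P (polynomial_ring :: ('n::finite poly_alg) ring)"
    and "\<And>i. i \<in> A \<Longrightarrow> f i \<notin> P"
  shows "(\<Prod>i\<in>A. f i) \<notin> P"
proof -
  interpret primeideal P polynomial_ring by fact
  have one: "1 \<notin> P" using I_notcarr one_imp_carrier by auto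
  have mult: "a * b \<notin> P" if "a \<notin> P" "b \<notin> P" for a b using I_prime[of a b] that by auto
  show ?thesis using assms(2)
    by (induction A rule: infinite_finite_induct) (simp_all add: one mult)
qed

text \<open>A cone that contains an interior cone is interior, so the covering cone of the fan is available
  in the complex.\<close>

lemma chain_cones_cover:
  fixes \<Sigma> :: "(rat ^ 'n::finite) set set"
  assumes fan: "is_fan \<Sigma>" and her: "hereditary \<Sigma>"
    and k: "k < CARD('n)" and \<sigma>: "\<sigma> \<in> chain_cones \<Sigma> k"
  obtains \<xi> where "\<xi> \<in> chain_cones \<Sigma> (k + 1)" "is_face \<sigma> \<xi>"
proof -
  have s: "\<sigma> \<in> \<Sigma>" "vec.dim \<sigma> = k" "\<not> \<sigma> \<subseteq> rat_boundary (\<Union>\<Sigma>)"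
    using \<sigma> by (auto simp: chain_cones_def interior_cones_def cones_def split: if_splits)
  then have "star_vertices \<Sigma> \<sigma> \<noteq> {}" using her unfolding hereditary_def by blast
  then obtain \<alpha> where \<alpha>: "\<alpha> \<in> \<Sigma>" "vec.dim \<alpha> = CARD('n)" "\<sigma> \<subseteq> \<alpha>"
    by (auto simp: star_vertices_def cones_def)
  then have "\<sigma> \<subset> \<alpha>" using s k by auto
  from fan_cover_exists[OF fan s(1) \<alpha>(1) this]
  obtain \<xi> where \<xi>: "\<xi> \<in> \<Sigma>" "is_face \<sigma> \<xi>" "vec.dim \<xi> = Suc (vec.dim \<sigma>)" by blast
  moreover have "\<not> \<xi> \<subseteq> rat_boundary (\<Union>\<Sigma>)"
    using s(3) \<xi>(2) unfolding is_face_def by blast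
  ultimately have "\<xi> \<in> chain_cones \<Sigma> (k + 1)"
    using s k by (auto simp: chain_cones_def interior_cones_def cones_def)
  then show ?thesis using that \<xi>(2) by blast
qed

text \<open>The differential is additive and commutes with scalars on representatives.\<close>

lemma boundaries_submodule:
  fixes \<Sigma> :: "(rat ^ 'n::finite) set set"
  assumes fan: "is_fan \<Sigma>"
  shows "submodule (boundary_map ori \<Sigma> (k + 1) ` carrier (chain_module \<Sigma> (k + 1)))
    polynomial_ring (chain_module \<Sigma> k)"
proof -
  interpret M: module polynomial_ring "chain_module \<Sigma> k" by (rule module_chain_module)
  let ?D = "boundary_coeffs ori \<Sigma> (k + 1)"
  let ?N = "boundary_map ori \<Sigma> (k + 1) ` carrier (chain_module \<Sigma> (k + 1))"
  have N: "?N = range (\<lambda>p. chain_of \<Sigma> k (?D p))"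
    by (simp add: chain_module_carrier image_image boundary_map_chain_of[OF fan])
  have D: "?D (\<lambda>\<alpha>. p \<alpha> + q \<alpha>) = (\<lambda>\<beta>. ?D p \<beta> + ?D q \<beta>)" "?D (\<lambda>\<alpha>. r * p \<alpha>) = (\<lambda>\<beta>. r * ?D p \<beta>)"
    for p q r
    by (auto simp: boundary_coeffs_def distrib_left sum.distrib sum_distrib_left mult.left_commute)
  have smult: "r \<odot>\<^bsub>chain_module \<Sigma> k\<^esub> x \<in> ?N" if x: "x \<in> ?N" for r x
  proof -
    obtain p where "x = chain_of \<Sigma> k (?D p)" using x unfolding N by blast
    then have "r \<odot>\<^bsub>chain_module \<Sigma> k\<^esub> x = chain_of \<Sigma> k (?D (\<lambda>\<alpha>. r * p \<alpha>))"
      by (simp only: chain_module_ops D(2))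
    then show ?thesis unfolding N by (rule range_eqI[where x = "\<lambda>\<alpha>. r * p \<alpha>"])
  qed
  show ?thesis
  proof (rule M.submoduleI)
    show sub: "?N \<subseteq> carrier (chain_module \<Sigma> k)" unfolding N by (auto simp: chain_module_carrier)
    have "?D (\<lambda>_. 0) = (\<lambda>_. 0)" by (rule ext) (simp add: boundary_coeffs_def)
    then show "\<zero>\<^bsub>chain_module \<Sigma> k\<^esub> \<in> ?N" unfolding N chain_module_ops by (metis rangeI)
    show "x \<oplus>\<^bsub>chain_module \<Sigma> k\<^esub> y \<in> ?N" if xy: "x \<in> ?N" "y \<in> ?N" for x y
    proof -
      obtain p q where "x = chain_of \<Sigma> k (?D p)" "y = chain_of \<Sigma> k (?D q)"
        using xy unfolding N by blast
      then have "x \<oplus>\<^bsub>chain_module \<Sigma> k\<^esub> y = chain_of \<Sigma> k (?D (\<lambda>\<alpha>. p \<alpha> + q \<alpha>))"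
        by (simp only: chain_module_ops D(1))
      then show ?thesis unfolding N by (rule range_eqI[where x = "\<lambda>\<alpha>. p \<alpha> + q \<alpha>"])
    qed
    show "\<ominus>\<^bsub>chain_module \<Sigma> k\<^esub> x \<in> ?N" if "x \<in> ?N" for x
    proof -
      have "x \<in> carrier (chain_module \<Sigma> k)" using that sub by blast
      then have "(\<ominus>\<^bsub>polynomial_ring\<^esub> \<one>\<^bsub>polynomial_ring\<^esub>) \<odot>\<^bsub>chain_module \<Sigma> k\<^esub> x = \<ominus>\<^bsub>chain_module \<Sigma> k\<^esub> x"
        using M.smult_l_minus[of "\<one>\<^bsub>polynomial_ring\<^esub>" x] M.smult_one[of x] by simp
      then show ?thesis using smult[OF that] by metis
    qed
  qed (rule smult)
qed

text \<open>Let \<open>A\<close> be the set of cones \<open>\<sigma>\<close> in degree \<open>d - i\<close> with \<open>I\<^sub>\<sigma> \<subseteq> P\<close>. At least \<open>i\<close> independent forms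
  vanish on \<open>\<sigma>\<close> and \<open>P\<close> contains at most \<open>i\<close> independent forms, so all cones in \<open>A\<close> have the same linear
  span. For the other cones \<open>\<sigma>\<close> some element of \<open>I\<^sub>\<sigma>\<close> lies outside \<open>P\<close>; the product \<open>s\<close> of
  these elements kills all components outside \<open>A\<close>. Each \<open>\<sigma> \<in> A\<close> is covered by an interior cone
  \<open>c \<sigma>\<close> of dimension one more, of which \<open>\<sigma>\<close> is the only face in \<open>A\<close>, since faces with equal span
  coincide. Placing the component of the chain at \<open>\<sigma>\<close>, multiplied by \<open>s\<close> and divided by the
  incidence number, on the cone \<open>c \<sigma>\<close> gives a chain whose boundary is the given one
  multiplied by \<open>s\<close>.\<close>

lemma chain_locally_boundary:
  fixes \<Sigma> :: "(rat ^ 'n::finite) set set" and p :: "(rat ^ 'n) set \<Rightarrow> 'n poly_alg"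
  assumes fan: "is_fan \<Sigma>" and her: "hereditary \<Sigma>" and ori: "is_orientation ori \<Sigma>"
    and i: "1 \<le> i" "i \<le> CARD('n)"
    and P: "primeideal P polynomial_ring" and dim: "vec.dim (linear_forms_in P) \<le> i"
  obtains s q where "s \<notin> P"
    "chain_of \<Sigma> (CARD('n) - i) (\<lambda>\<sigma>. s * p \<sigma>) =
     boundary_map ori \<Sigma> (CARD('n) - i + 1) (chain_of \<Sigma> (CARD('n) - i + 1) q)"
proof -
  define k where "k = CARD('n) - i"
  let ?L = "linear_forms_in P"
  let ?S = "chain_cones \<Sigma> k"
  have k: "k < CARD('n)" using i by (simp add: k_def)
  have idl: "ideal P polynomial_ring" using P by (rule primeideal.axioms(1))
  have S: "\<sigma> \<in> \<Sigma>" "vec.dim \<sigma> = m" if "\<sigma> \<in> chain_cones \<Sigma> m" for \<sigma> m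
    using that by (auto simp: chain_cones_def interior_cones_def cones_def split: if_splits)
  have finS: "finite ?S" by (rule finite_chain_cones[OF fan])
  define A where "A = {\<sigma> \<in> ?S. vanishing_forms \<sigma> \<subseteq> ?L}"
  have A: "vanishing_forms \<sigma> = ?L" if "\<sigma> \<in> A" for \<sigma>
  proof (rule vec.subspace_dim_equal)
    show "vec.subspace (vanishing_forms \<sigma>)" by (rule subspace_vanishing_forms)
    show "vec.subspace ?L" by (rule subspace_linear_forms_in[OF idl])
    show "vanishing_forms \<sigma> \<subseteq> ?L" using that by (simp add: A_def)
    have "vec.dim \<sigma> = k" using that S by (auto simp: A_def)
    then show "vec.dim ?L \<le> vec.dim (vanishing_forms \<sigma>)"
      using dim_vanishing_forms[of \<sigma>] dim i by (simp add: k_def)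
  qed
  have "\<exists>f. f \<in> cone_ideal \<sigma> \<and> f \<notin> P" if "\<sigma> \<in> ?S - A" for \<sigma>
    using that by (auto simp: A_def linear_forms_in_def intro: linear_form_in_cone_ideal)
  then obtain f where f: "\<And>\<sigma>. \<sigma> \<in> ?S - A \<Longrightarrow> f \<sigma> \<in> cone_ideal \<sigma>" "\<And>\<sigma>. \<sigma> \<in> ?S - A \<Longrightarrow> f \<sigma> \<notin> P"
    by metis
  define s where "s = (\<Prod>\<sigma>\<in>?S - A. f \<sigma>)"
  have sP: "s \<notin> P" unfolding s_def by (rule prod_notin_prime[OF P f(2)])
  have s_in: "s \<in> cone_ideal \<beta>" if \<beta>: "\<beta> \<in> ?S - A" for \<beta>
  proof -
    have "s = f \<beta> * (\<Prod>\<sigma>\<in>?S - A - {\<beta>}. f \<sigma>)"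
      unfolding s_def using finS \<beta> by (intro prod.remove) auto
    then show ?thesis using cone_idealD(4)[OF f(1)[OF \<beta>]] by simp
  qed
  have "\<exists>\<xi>. \<xi> \<in> chain_cones \<Sigma> (k + 1) \<and> is_face \<sigma> \<xi>" if "\<sigma> \<in> A" for \<sigma>
    using chain_cones_cover[OF fan her k, of \<sigma>] that by (auto simp: A_def)
  then obtain c where c: "\<And>\<sigma>. \<sigma> \<in> A \<Longrightarrow> c \<sigma> \<in> chain_cones \<Sigma> (k + 1)" "\<And>\<sigma>. \<sigma> \<in> A \<Longrightarrow> is_face \<sigma> (c \<sigma>)"
    by metis
  have finA: "finite A" using finS by (simp add: A_def)
  let ?C = "\<lambda>r. Poly_Mapping.single 0 (r :: rat) :: 'n poly_alg"
  \<comment> \<open>A sum over \<open>A\<close> rather than a choice of the cone covered by \<open>\<xi>\<close>: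
    it makes the boundary computable by exchanging two sums.\<close>
  define q where "q \<xi> = (\<Sum>\<sigma>\<in>A. if c \<sigma> = \<xi> then ?C (inverse (incidence ori \<xi> \<sigma>)) * (s * p \<sigma>) else 0)" for \<xi>
  have "boundary_coeffs ori \<Sigma> (k + 1) q \<beta> - s * p \<beta> \<in> cone_ideal \<beta>" if \<beta>: "\<beta> \<in> ?S" for \<beta>
  proof (cases "\<beta> \<in> A")
    case False
    then have "s \<in> cone_ideal \<beta>" using s_in \<beta> by blast
    moreover have "boundary_coeffs ori \<Sigma> (k + 1) q \<beta> = s * (\<Sum>\<alpha> | \<alpha> \<in> chain_cones \<Sigma> (k + 1) \<and> is_face \<beta> \<alpha>.
        ?C (incidence ori \<alpha> \<beta>) *
        (\<Sum>\<sigma>\<in>A. if c \<sigma> = \<alpha> then ?C (inverse (incidence ori \<alpha> \<sigma>)) * p \<sigma> else 0))"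
      unfolding boundary_coeffs_def q_def
      by (simp add: sum_distrib_left if_distrib mult_ac cong: if_cong)
    ultimately show ?thesis
      by (metis (no_types, lifting) cone_idealD(4,5))
  next
    case True
    have "boundary_coeffs ori \<Sigma> (k + 1) q \<beta> =
       (\<Sum>\<alpha> | \<alpha> \<in> chain_cones \<Sigma> (k + 1) \<and> is_face \<beta> \<alpha>. \<Sum>\<sigma>\<in>A. if c \<sigma> = \<alpha>
          then ?C (incidence ori \<alpha> \<beta>) * (?C (inverse (incidence ori \<alpha> \<sigma>)) * (s * p \<sigma>)) else 0)"
      unfolding boundary_coeffs_def q_def
      by (simp add: sum_distrib_left if_distrib cong: if_cong)
    also have "\<dots> = (\<Sum>\<sigma>\<in>A. \<Sum>\<alpha> | \<alpha> \<in> chain_cones \<Sigma> (k + 1) \<and> is_face \<beta> \<alpha>. if c \<sigma> = \<alpha>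
          then ?C (incidence ori \<alpha> \<beta>) * (?C (inverse (incidence ori \<alpha> \<sigma>)) * (s * p \<sigma>)) else 0)"
      by (rule sum.swap)
    also have "\<dots> = (\<Sum>\<sigma>\<in>A. if \<sigma> = \<beta> then s * p \<beta> else 0)"
    proof (rule sum.cong[OF refl])
      fix \<sigma> assume \<sigma>: "\<sigma> \<in> A"
      \<comment> \<open>Both cones lie in \<open>A\<close>, so the same forms vanish on them.\<close>
      have "is_face \<beta> (c \<sigma>) \<longleftrightarrow> \<sigma> = \<beta>"
        using face_eqI_vanishing_forms[OF c(2)[OF \<sigma>], of \<beta>] A[OF \<sigma>] A[OF True] c(2)[OF \<sigma>] by auto
      moreover have "?C (incidence ori (c \<beta>) \<beta>) * (?C (inverse (incidence ori (c \<beta>) \<beta>)) * (s * p \<beta>)) = s * p \<beta>"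
      proof -
        have "incidence ori (c \<beta>) \<beta> \<noteq> 0"
        proof (rule incidence_nonzero[OF ori])
          show "c \<beta> \<in> \<Sigma>" "\<beta> \<in> \<Sigma>" using S c(1)[OF True] \<beta> by auto
          show "\<beta> \<subseteq> c \<beta>" using c(2)[OF True] by (auto simp: is_face_def)
          show "vec.dim (c \<beta>) = Suc (vec.dim \<beta>)" using S(2)[OF c(1)[OF True]] S(2)[OF \<beta>] by simp
        qed
        then have "?C (incidence ori (c \<beta>) \<beta>) * ?C (inverse (incidence ori (c \<beta>) \<beta>)) = 1"
          by (simp add: mult_single)
        then show ?thesis by (simp only: mult.assoc[symmetric] mult_1)
      qed
      ultimately show "(\<Sum>\<alpha> | \<alpha> \<in> chain_cones \<Sigma> (k + 1) \<and> is_face \<beta> \<alpha>. if c \<sigma> = \<alpha>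
          then ?C (incidence ori \<alpha> \<beta>) * (?C (inverse (incidence ori \<alpha> \<sigma>)) * (s * p \<sigma>)) else 0) =
          (if \<sigma> = \<beta> then s * p \<beta> else 0)"
        using c(1)[OF \<sigma>] finite_chain_cones[OF fan, of "k + 1"] by (auto simp: sum.delta)
    qed
    also have "\<dots> = s * p \<beta>" using True finA by simp
    finally show ?thesis by (simp add: cone_idealD(1))
  qed
  then have "chain_of \<Sigma> k (boundary_coeffs ori \<Sigma> (k + 1) q) = chain_of \<Sigma> k (\<lambda>\<sigma>. s * p \<sigma>)"
    by (rule chain_of_eqI)
  then have "chain_of \<Sigma> k (\<lambda>\<sigma>. s * p \<sigma>) = boundary_map ori \<Sigma> (k + 1) (chain_of \<Sigma> (k + 1) q)"
    using boundary_map_chain_of[OF fan, of ori "k + 1" q] by simp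
  then show ?thesis using that[OF sP] by (simp add: k_def)
qed

text \<open>Every cycle is a boundary up to a factor outside \<open>P\<close>.\<close>

lemma homology_locally_zero:
  fixes \<Sigma> :: "(rat ^ 'n::finite) set set"
  assumes fan: "is_fan \<Sigma>" and her: "hereditary \<Sigma>" and ori: "is_orientation ori \<Sigma>"
    and i: "1 \<le> i" "i \<le> CARD('n)"
    and P: "primeideal P polynomial_ring" and dim: "vec.dim (linear_forms_in P) \<le> i"
  shows "P \<notin> module_support polynomial_ring (homology_module ori \<Sigma> (CARD('n) - i))"
    and "P \<notin> associated_primes polynomial_ring (homology_module ori \<Sigma> (CARD('n) - i))"
proof -
  let ?k = "CARD('n) - i"
  let ?M = "chain_module \<Sigma> ?k"
  let ?K = "a_kernel ?M (chain_module \<Sigma> (?k - 1)) (boundary_map ori \<Sigma> ?k)"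
  let ?N = "boundary_map ori \<Sigma> (?k + 1) ` carrier (chain_module \<Sigma> (?k + 1))"
  have K: "?K \<subseteq> carrier ?M" by (auto simp: a_kernel_def kernel_def)
  have "boundary_map ori \<Sigma> ?k (chain_of \<Sigma> ?k (\<lambda>_. 0)) = chain_of \<Sigma> (?k - 1) (\<lambda>_. 0)"
    unfolding boundary_map_chain_of[OF fan] by (rule chain_of_eqI) (simp add: boundary_coeffs_def cone_idealD(1))
  then have K0: "\<zero>\<^bsub>?M\<^esub> \<in> ?K"
    by (auto simp: a_kernel_def kernel_def chain_module_ops chain_module_carrier)
  have kill: "\<exists>s\<in>carrier polynomial_ring - P. s \<odot>\<^bsub>?M\<^esub> x \<in> ?N" if x: "x \<in> ?K" for x
  proof -
    obtain p where p: "x = chain_of \<Sigma> ?k p" using x K unfolding chain_module_carrier by blast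
    obtain s q where sq: "s \<notin> P" "chain_of \<Sigma> ?k (\<lambda>\<sigma>. s * p \<sigma>) =
        boundary_map ori \<Sigma> (?k + 1) (chain_of \<Sigma> (?k + 1) q)"
      by (rule chain_locally_boundary[OF fan her ori i P dim])
    have "s \<odot>\<^bsub>?M\<^esub> x \<in> ?N"
      unfolding p chain_module_ops sq(2) chain_module_carrier by blast
    then show ?thesis using sq(1) by auto
  qed
  show "P \<notin> module_support polynomial_ring (homology_module ori \<Sigma> ?k)"
    "P \<notin> associated_primes polynomial_ring (homology_module ori \<Sigma> ?k)"
    unfolding homology_module_def
    by (rule locally_zero_quotient[OF module_chain_module boundaries_submodule[OF fan] K K0 P kill]; assumption)+
qed

theorem theorem1:
  fixes \<Sigma> :: "(rat ^ 'n::finite) set set"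
    and ori :: "(rat ^ 'n) set \<Rightarrow> (rat ^ 'n) list"
    and i :: nat
  assumes "is_fan \<Sigma>"
    and "full_dimensional \<Sigma>"
    and "hereditary \<Sigma>"
    and "is_orientation ori \<Sigma>"
    and "1 \<le> i" and "i \<le> CARD('n) - 1"
  shows "(\<forall>P \<in> module_support polynomial_ring (homology_module ori \<Sigma> (CARD('n) - i)).
            enat (i + 1) \<le> codimension polynomial_ring P) \<and>
         (\<forall>P \<in> associated_primes polynomial_ring (homology_module ori \<Sigma> (CARD('n) - i)).
            codimension polynomial_ring P = enat (i + 1) \<longrightarrow> linear_prime P)"
proof (intro conjI ballI impI)
  have i: "i \<le> CARD('n)" using assms(6) by simp
  note locally_zero = homology_locally_zero[OF assms(1,3,4,5) i]
  fix P
  {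
    assume supp: "P \<in> module_support polynomial_ring (homology_module ori \<Sigma> (CARD('n) - i))"
    then have P: "primeideal P polynomial_ring" by (simp add: module_support_def)
    then have "\<not> vec.dim (linear_forms_in P) \<le> i" using locally_zero(1) supp by blast
    then have "i + 1 \<le> vec.dim (linear_forms_in P)" by simp
    then show "enat (i + 1) \<le> codimension polynomial_ring P"
      by (rule codimension_ge_linear_forms(1)[OF P])
  }
  assume ass: "P \<in> associated_primes polynomial_ring (homology_module ori \<Sigma> (CARD('n) - i))"
    and cod: "codimension polynomial_ring P = enat (i + 1)"
  then have P: "primeideal P polynomial_ring" by (simp add: associated_primes_def)
  then have "\<not> vec.dim (linear_forms_in P) \<le> i" using locally_zero(2) ass by blast
  then have "i + 1 \<le> vec.dim (linear_forms_in P)" by simp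
  then show "linear_prime P"
    using cod by (rule codimension_ge_linear_forms(2)[OF P])
qed

end
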